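(* Let $\mathcal{I}'\subseteq\mathcal{I}$ and $\mathcal{J}'\subseteq\mathcal{J}$ be ideals of $R$ such that each of the pairs $\{\mathcal{I},\mathcal{J}\}$, $\{\mathcal{I}',\mathcal{J}\}$, $\{\mathcal{I},\mathcal{J}'\}$ is Tor-independent. Let $\mathcal{X},\mathcal{Y},\mathscr{S},\mathscr{T}$ be free resolutions over $R$ of $R/\mathcal{I}$, $R/\mathcal{J}$, $R/\mathcal{I}'$, $R/\mathcal{J}'$, respectively, each with $R$ in degree $0$. Suppose $\mathcal{I}'\subseteq\mathcal{I}^2$ and $\mathcal{J}'\subseteq\mathcal{J}^2$, with both $\mathcal{I}$ and $\mathcal{J}$ generated by regular sequences. If the resolutions $\mathcal{X}$, $\mathcal{Y}$, $\mathscr{S}$, $\mathscr{T}$ are all minimal, and the chain maps $\phi:\mathscr{S}\to\mathcal{X}$ and $\psi:\mathscr{T}\to\mathcal{Y}$ lifting the natural surjections $R/\mathcal{I}'\to R/\mathcal{I}$ and $R/\mathcal{J}'\to R/\mathcal{J}$ are chosen so that $\phi_0=1$, $\psi_0=1$, $\phi(\mathscr{S}_i)\subseteq\mathcal{I}\mathcal{X}_i$ and $\psi(\mathscr{T}_i)\subseteq\mathcal{J}\mathcal{Y}_i$ for all $i\ge1$, then the complex $\operatorname{Cone}(\Omega)$ (defined from these data in the context) is minimal.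
   Context: $R$ is a commutative noetherian ring that is either local with maximal ideal $\mathfrak{M}_R$ or standard graded with homogeneous maximal ideal $\mathfrak{M}_R$; in the graded case all ideals are homogeneous, regular sequences consist of homogeneous elements, and all resolutions and chain maps are graded. A complex $\mathcal{C}$ of free $R$-modules is minimal if $\partial^{\mathcal{C}}(\mathcal{C})\subseteq\mathfrak{M}_R\mathcal{C}$. Ideals $\mathcal{A},\mathcal{B}$ are Tor-independent if $\operatorname{Tor}_i^R(R/\mathcal{A},R/\mathcal{B})=0$ for all $i\ge1$. For a complex $\mathcal C$, $\mathcal C_{\ge1}$ is the hard truncation: $(\mathcal C_{\ge1})_q=\mathcal C_q$ for $q\ge1$ and $0$ otherwise, with $\partial_q^{\mathcal C_{\ge1}}=\partial_q^{\mathcal C}$ for $q>1$ and $0$ for $q\le1$. The shift is $(\Sigma^{\ell}\mathcal C)_i=\mathcal C_{i-\ell}$ with $\partial^{\Sigma^\ell\mathcal C}=(-1)^\ell\partial^{\mathcal C}$. Tensor products carry the differential $\partial(a\otimes b)=\partial(a)\otimes b+(-1)^{|a|}a\otimes\partial(b)$, where $|\cdot|$ is homological degree. Star product: $\mathcal{X}*_R\mathcal{Y}$ is the complex with $(\mathcal{X}*_R\mathcal{Y})_n=(\mathcal{X}_{\ge1}\otimes_R\mathcal{Y}_{\ge1})_{n+1}$ for $n\ge1$, $\mathcal{X}_0\otimes_R\mathcal{Y}_0$ for $n=0$, and $0$ for $n<0$; its differential is $\partial_{n+1}^{\mathcal{X}_{\ge1}\otimes\mathcal{Y}_{\ge1}}$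 for $n\ge2$, $\partial_1^{\mathcal{X}}\otimes\partial_1^{\mathcal{Y}}$ for $n=1$, and $0$ for $n\le0$. Write $a*b$ for the element given by $a\otimes b$. Given $\phi,\psi$ (with $\phi_0=\psi_0=1$), define $\Phi:\Sigma^{-1}(\mathscr{S}_{\ge1}\otimes_R\mathcal{Y})\to\mathcal{X}*_R\mathcal{Y}$ by $\Phi(\alpha\otimes\beta)=(-1)^{|\alpha|+|\beta|}\phi(\alpha)*\beta$ if $|\beta|>0$; $\partial_1^{\mathscr{S}}(\alpha)*\beta$ if $|\beta|=0,|\alpha|=1$; $0$ if $|\beta|=0,|\alpha|>1$. Define $\Psi:\Sigma^{-1}(\mathcal{X}\otimes_R\mathscr{T}_{\ge1})\to\mathcal{X}*_R\mathcal{Y}$ by $\Psi(\alpha\otimes\beta)=(-1)^{|\alpha|+|\beta|-1}\alpha*\psi(\beta)$ if $|\alpha|>0$; $\alpha*\partial_1^{\mathscr{T}}(\beta)$ if $|\alpha|=0,|\beta|=1$; $0$ if $|\alpha|=0,|\beta|>1$. Here $|\alpha|,|\beta|$ are the degrees in the original (unshifted) complexes, and $\mathscr{S}_0=\mathcal{X}_0=\mathscr{T}_0=\mathcal{Y}_0=R$. These are chain maps. Set $\Omega=(\Phi\ \ \Psi):\Sigma^{-1}(\mathscr{S}_{\ge1}\otimes_R\mathcal{Y})\oplus\Sigma^{-1}(\mathcal{X}\otimes_R\mathscr{T}_{\ge1})\to\mathcal{X}*_R\mathcal{Y}$. For a chain map $f:\mathcal C\to\mathcal D$, $\operatorname{Cone}(f)_i=\mathcal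 D_i\oplus\mathcal C_{i-1}$ with differential $(d,c)\mapsto(\partial^{\mathcal D}(d)+f(c),-\partial^{\mathcal C}(c))$. *)

theory Defs
  imports Complex_Main "HOL-Library.Poly_Mapping"
begin

text \<open>The ring R is a type of class \<open>comm_ring_1\<close>; its ideals are the submodules of R over itself.\<close>

abbreviation is_ideal :: "'a::comm_ring_1 set \<Rightarrow> bool"
  where "is_ideal \<equiv> module.subspace (*)"

abbreviation ideal_gen :: "'a::comm_ring_1 set \<Rightarrow> 'a set"
  where "ideal_gen \<equiv> module.span (*)"

definition ideal_prod :: "'a::comm_ring_1 set \<Rightarrow> 'a set \<Rightarrow> 'a set"
  where "ideal_prod I J = ideal_gen {a * b | a b. a \<in> I \<and> b \<in> J}"

definition noetherian :: "'a::comm_ring_1 itself \<Rightarrow> bool"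
  where "noetherian _ \<longleftrightarrow> (\<forall>I::'a set. is_ideal I \<longrightarrow> (\<exists>A. finite A \<and> I = ideal_gen A))"

definition maximal_ideal :: "'a::comm_ring_1 set \<Rightarrow> bool"
  where "maximal_ideal m \<longleftrightarrow> is_ideal m \<and> m \<noteq> UNIV \<and>
    (\<forall>I. is_ideal I \<and> m \<subseteq> I \<longrightarrow> I = m \<or> I = UNIV)"

text \<open>That is, R is local with maximal ideal m.\<close>

definition local_ring :: "'a::comm_ring_1 set \<Rightarrow> bool"
  where "local_ring m \<longleftrightarrow> (\<forall>n. maximal_ideal n \<longleftrightarrow> n = m)"

text \<open>A regular sequence is allowed to be empty; the quotient by it is required to be nonzero.\<close>

definition regular_sequence :: "'a::comm_ring_1 list \<Rightarrow> bool"
  where "regular_sequence xs \<longleftrightarrow>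
    (\<forall>k < length xs. \<forall>a. xs ! k * a \<in> ideal_gen (set (take k xs)) \<longrightarrow> a \<in> ideal_gen (set (take k xs))) \<and>
    ideal_gen (set xs) \<noteq> UNIV"

text \<open>A grading is indexed by the integers (with zero components in negative degrees) so that it can
  be combined with the twists of graded free modules.\<close>

definition is_grading :: "(int \<Rightarrow> 'a::comm_ring_1 set) \<Rightarrow> bool"
  where "is_grading G \<longleftrightarrow>
    (\<forall>n. 0 \<in> G n \<and> (\<forall>a\<in>G n. \<forall>b\<in>G n. a - b \<in> G n)) \<and>
    1 \<in> G 0 \<and>
    (\<forall>i j. \<forall>a\<in>G i. \<forall>b\<in>G j. a * b \<in> G (i + j)) \<and>
    (\<forall>a. \<exists>!c. (\<forall>n. c n \<in> G n) \<and> finite {n. c n \<noteq> 0} \<and> a = (\<Sum>n | c n \<noteq> 0. c n))"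

definition homogeneous_elements :: "(int \<Rightarrow> 'a set) \<Rightarrow> 'a set"
  where "homogeneous_elements G = (\<Union>n. G n)"

definition homogeneous_ideal :: "(int \<Rightarrow> 'a::comm_ring_1 set) \<Rightarrow> 'a set \<Rightarrow> bool"
  where "homogeneous_ideal G I \<longleftrightarrow> is_ideal I \<and> I = ideal_gen (I \<inter> homogeneous_elements G)"

text \<open>Standard graded with homogeneous maximal ideal m: R is nonnegatively graded, generated as a
  ring by its components of degree 0 and 1, and m is a homogeneous maximal ideal containing all
  proper homogeneous ideals.  When the degree 0 component is a field, m is the ideal of elements
  whose degree 0 component vanishes.\<close>

definition standard_graded_ring :: "(int \<Rightarrow> 'a::comm_ring_1 set) \<Rightarrow> 'a set \<Rightarrow> bool"
  where "standard_graded_ring G m \<longleftrightarrow>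
    is_grading G \<and> (\<forall>n<0. G n = {0}) \<and>
    (\<forall>U. G 0 \<union> G 1 \<subseteq> U \<and> (\<forall>a\<in>U. \<forall>b\<in>U. a + b \<in> U \<and> a * b \<in> U) \<longrightarrow> U = UNIV) \<and>
    homogeneous_ideal G m \<and> maximal_ideal m \<and>
    (\<forall>K. homogeneous_ideal G K \<and> K \<noteq> UNIV \<longrightarrow> K \<subseteq> m)"

text \<open>The free module on a set B is the set of finitely supported functions with support in B.\<close>

definition smul :: "'a::comm_ring_1 \<Rightarrow> ('x \<Rightarrow>\<^sub>0 'a) \<Rightarrow> ('x \<Rightarrow>\<^sub>0 'a)"
  where "smul r = Poly_Mapping.map ((*) r)"

definition free_mod :: "'x set \<Rightarrow> ('x \<Rightarrow>\<^sub>0 'a::comm_ring_1) set"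
  where "free_mod B = {v. Poly_Mapping.keys v \<subseteq> B}"

abbreviation gen :: "'x \<Rightarrow> ('x \<Rightarrow>\<^sub>0 'a::comm_ring_1)"
  where "gen x \<equiv> Poly_Mapping.single x 1"

definition lin_ext :: "('x \<Rightarrow> ('y \<Rightarrow>\<^sub>0 'a::comm_ring_1)) \<Rightarrow> ('x \<Rightarrow>\<^sub>0 'a) \<Rightarrow> ('y \<Rightarrow>\<^sub>0 'a)"
  where "lin_ext f v = (\<Sum>x\<in>Poly_Mapping.keys v. smul (Poly_Mapping.lookup v x) (f x))"

definition ideal_times :: "'a::comm_ring_1 set \<Rightarrow> ('x \<Rightarrow>\<^sub>0 'a) set \<Rightarrow> ('x \<Rightarrow>\<^sub>0 'a) set"
  where "ideal_times I M = module.span smul {smul r v | r v. r \<in> I \<and> v \<in> M}"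

lemma lookup_smul [simp]: "Poly_Mapping.lookup (smul r v) x = r * Poly_Mapping.lookup v x"
  by (simp add: smul_def map.rep_eq when_def)

lemma module_mult: "module ((*) :: 'a::comm_ring_1 \<Rightarrow> 'a \<Rightarrow> 'a)"
  by unfold_locales (simp_all add: algebra_simps)

interpretation free: module "smul :: 'a::comm_ring_1 \<Rightarrow> ('x \<Rightarrow>\<^sub>0 'a) \<Rightarrow> ('x \<Rightarrow>\<^sub>0 'a)"
  by unfold_locales (auto intro!: poly_mapping_eqI simp: lookup_add algebra_simps)

lemma lin_ext_superset:
  assumes "finite A" "Poly_Mapping.keys v \<subseteq> A"
  shows "lin_ext f v = (\<Sum>x\<in>A. smul (Poly_Mapping.lookup v x) (f x))"
  unfolding lin_ext_def by (rule sum.mono_neutral_left) (use assms in \<open>auto simp: in_keys_iff\<close>)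

lemma lin_ext_gen [simp]: "lin_ext f (gen x) = f x"
  by (simp add: lin_ext_def)

lemma module_hom_lin_ext:
  fixes f :: "'x \<Rightarrow> ('y \<Rightarrow>\<^sub>0 'a::comm_ring_1)"
  shows "module_hom smul smul (lin_ext f)"
proof (unfold_locales)
  fix v w :: "'x \<Rightarrow>\<^sub>0 'a" and r
  let ?A = "Poly_Mapping.keys v \<union> Poly_Mapping.keys w"
  have "lin_ext f (v + w) = (\<Sum>x\<in>?A. smul (Poly_Mapping.lookup (v + w) x) (f x))"
    by (rule lin_ext_superset) (auto simp: Poly_Mapping.keys_add)
  moreover have "lin_ext f v = (\<Sum>x\<in>?A. smul (Poly_Mapping.lookup v x) (f x))"
    and "lin_ext f w = (\<Sum>x\<in>?A. smul (Poly_Mapping.lookup w x) (f x))"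
    by (rule lin_ext_superset; auto)+
  ultimately show "lin_ext f (v + w) = lin_ext f v + lin_ext f w"
    by (simp add: lookup_add free.scale_left_distrib sum.distrib)
  have "lin_ext f (smul r v) = (\<Sum>x\<in>Poly_Mapping.keys v. smul (Poly_Mapping.lookup (smul r v) x) (f x))"
    by (rule lin_ext_superset) (auto simp: in_keys_iff)
  then show "lin_ext f (smul r v) = smul r (lin_ext f v)"
    by (simp add: lin_ext_def free.scale_sum_right)
qed

lemma expand_gen: "(v :: 'x \<Rightarrow>\<^sub>0 'a::comm_ring_1) = (\<Sum>x\<in>Poly_Mapping.keys v. smul (Poly_Mapping.lookup v x) (gen x))"
proof (rule poly_mapping_eqI)
  fix y
  have "Poly_Mapping.lookup (\<Sum>x\<in>Poly_Mapping.keys v. smul (Poly_Mapping.lookup v x) (gen x)) y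
      = (\<Sum>x\<in>Poly_Mapping.keys v. if x = y then Poly_Mapping.lookup v x else 0)"
    by (auto simp only: lookup_sum lookup_smul lookup_single when_def mult_1_right mult_zero_right
        intro!: sum.cong split: if_split)
  also have "\<dots> = Poly_Mapping.lookup v y"
    by (simp add: in_keys_iff)
  finally show "Poly_Mapping.lookup v y
      = Poly_Mapping.lookup (\<Sum>x\<in>Poly_Mapping.keys v. smul (Poly_Mapping.lookup v x) (gen x)) y" ..
qed

lemma module_hom_eq_on_gens:
  assumes f: "module_hom smul smul f" and g: "module_hom smul smul g"
    and v: "v \<in> free_mod B" and eq: "\<And>x. x \<in> B \<Longrightarrow> f (gen x) = g (gen x)"
  shows "f v = (g (v :: 'x \<Rightarrow>\<^sub>0 'a::comm_ring_1) :: 'y \<Rightarrow>\<^sub>0 'a)"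
proof -
  have "h v = lin_ext (\<lambda>x. h (gen x)) v" if "module_hom smul smul h" for h :: "('x \<Rightarrow>\<^sub>0 'a) \<Rightarrow> ('y \<Rightarrow>\<^sub>0 'a)"
    by (subst expand_gen[of v]) (simp add: module_hom.sum[OF that] module_hom.scale[OF that] lin_ext_def)
  moreover have "lin_ext (\<lambda>x. f (gen x)) v = lin_ext (\<lambda>x. g (gen x)) v"
    unfolding lin_ext_def by (rule sum.cong) (use v eq in \<open>auto simp: free_mod_def\<close>)
  ultimately show ?thesis
    using f g by metis
qed

text \<open>The tensor product of the free modules on B and C is the free module on the product of B and C.
  The basis elements below carry in addition the homological degrees i and j of the two
  factors, so that the summands of a tensor product of complexes stay apart:
  \<open>tens i v j w\<close> is the tensor product of v, of degree i, and w, of degree j.\<close>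

definition tens :: "int \<Rightarrow> ('x \<Rightarrow>\<^sub>0 'a::comm_ring_1) \<Rightarrow> int \<Rightarrow> ('y \<Rightarrow>\<^sub>0 'a) \<Rightarrow> ((int \<times> 'x) \<times> (int \<times> 'y)) \<Rightarrow>\<^sub>0 'a"
  where "tens i v j w = lin_ext (\<lambda>x. lin_ext (\<lambda>y. gen ((i, x), (j, y))) w) v"

lemma tens_gen [simp]: "tens i (gen x) j (gen y) = gen ((i, x), (j, y))"
  by (simp add: tens_def)

lemma module_hom_cmult:
  assumes "module_hom smul smul f"
  shows "module_hom smul smul (\<lambda>v. smul r (f v) :: 'y \<Rightarrow>\<^sub>0 'a::comm_ring_1)"
proof -
  interpret module_hom smul smul f by fact
  show ?thesis
    by unfold_locales (simp_all add: add scale free.scale_right_distrib mult.commute)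
qed

lemma module_hom_plus:
  assumes "module_hom smul smul f" "module_hom smul smul g"
  shows "module_hom smul smul (\<lambda>v. f v + g v :: 'y \<Rightarrow>\<^sub>0 'a::comm_ring_1)"
proof -
  interpret f: module_hom smul smul f by fact
  interpret g: module_hom smul smul g by fact
  show ?thesis
    by unfold_locales (simp_all add: f.add f.scale g.add g.scale free.scale_right_distrib)
qed

lemma module_hom_comp:
  assumes "module_hom smul smul f" "module_hom smul smul g"
  shows "module_hom smul smul (\<lambda>v. g (f v))"
proof -
  interpret f: module_hom smul smul f by fact
  interpret g: module_hom smul smul g by fact
  show ?thesis
    by unfold_locales (simp_all add: f.add f.scale g.add g.scale)
qed

lemma module_hom_zero: "module_hom smul smul (\<lambda>v :: 'x \<Rightarrow>\<^sub>0 'a::comm_ring_1. 0 :: 'y \<Rightarrow>\<^sub>0 'a)"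
  by unfold_locales simp_all

lemma module_hom_If:
  "module_hom smul smul f \<Longrightarrow> module_hom smul smul g \<Longrightarrow> module_hom smul smul (\<lambda>v. if P then f v else g v)"
  by (cases P) simp_all

lemma module_hom_tens_left: "module_hom smul smul (\<lambda>v. tens i v j w)"
  unfolding tens_def by (rule module_hom_lin_ext)

lemma module_hom_tens_right: "module_hom smul smul (\<lambda>w. tens i v j w)"
proof -
  interpret m: module_hom smul smul "lin_ext (\<lambda>y. gen ((i, x), (j, y)) :: _ \<Rightarrow>\<^sub>0 'a)" for x
    by (rule module_hom_lin_ext)
  show ?thesis
    by unfold_locales
      (simp_all add: tens_def lin_ext_def[where v = v] m.add m.scale free.scale_right_distrib
        sum.distrib free.scale_sum_right mult.commute)
qed

lemma tens_universal:
  fixes f :: "('x \<Rightarrow>\<^sub>0 'a::comm_ring_1) \<Rightarrow> ('y \<Rightarrow>\<^sub>0 'a) \<Rightarrow> ('z \<Rightarrow>\<^sub>0 'a)"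
  assumes l: "\<And>w. module_hom smul smul (\<lambda>v. f v w)" and r: "\<And>v. module_hom smul smul (f v)"
  defines "g \<equiv> lin_ext (\<lambda>((_, x), (_, y)). f (gen x) (gen y))"
  shows "module_hom smul smul g" "g (tens i v j w) = f v w"
proof -
  show g: "module_hom smul smul g"
    unfolding g_def by (rule module_hom_lin_ext)
  have *: "g (tens i (gen x) j w) = f (gen x) w" for x
    by (rule module_hom_eq_on_gens[OF module_hom_comp[OF module_hom_tens_right g] r, of _ UNIV])
      (simp_all add: g_def free_mod_def)
  show "g (tens i v j w) = f v w"
    by (rule module_hom_eq_on_gens[OF module_hom_comp[OF module_hom_tens_left g] l, of _ UNIV])
      (simp_all add: * free_mod_def)
qed

lemma tens_universal_unique:
  assumes "module_hom smul smul g" "module_hom smul smul h"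
    and "\<And>v w. v \<in> free_mod B \<Longrightarrow> w \<in> free_mod C \<Longrightarrow> g (tens i v j w) = h (tens i v j w)"
    and "u \<in> free_mod {((i, x), (j, y)) | x y. x \<in> B \<and> y \<in> C}"
  shows "g u = h u"
proof (rule module_hom_eq_on_gens[OF assms(1,2,4)])
  fix p assume "p \<in> {((i, x), (j, y)) | x y. x \<in> B \<and> y \<in> C}"
  then obtain x y where "p = ((i, x), (j, y))" "x \<in> B" "y \<in> C" by blast
  then show "g (gen p) = h (gen p)"
    using assms(3)[of "gen x" "gen y"] by (simp add: free_mod_def)
qed

text \<open>The Koszul sign, the i-th power of -1 for an integer exponent i.\<close>

definition ksign :: "int \<Rightarrow> 'a::comm_ring_1"
  where "ksign i = (if even i then 1 else - 1)"

text \<open>In homological degree n, a complex C of free modules is the free module on \<open>gens C n\<close>.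
  Linear maps on it are given by linear maps on all finitely supported functions, of which only the
  restriction matters.  (A linear map defined on a free submodule extends by 0 on the other
  basis elements.)\<close>

record (overloaded) ('x, 'a) cplx =
  gens :: "int \<Rightarrow> 'x set"
  bd :: "int \<Rightarrow> ('x \<Rightarrow>\<^sub>0 'a::comm_ring_1) \<Rightarrow> ('x \<Rightarrow>\<^sub>0 'a)"

definition md :: "('x, 'a::comm_ring_1) cplx \<Rightarrow> int \<Rightarrow> ('x \<Rightarrow>\<^sub>0 'a) set"
  where "md C n = free_mod (gens C n)"

definition free_complex :: "('x, 'a::comm_ring_1) cplx \<Rightarrow> bool"
  where "free_complex C \<longleftrightarrow> (\<forall>n. module_hom smul smul (bd C n) \<and> bd C n ` md C n \<subseteq> md C (n - 1) \<and>
    (\<forall>v\<in>md C n. bd C (n - 1) (bd C n v) = 0))"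

definition chain_map :: "('x, 'a::comm_ring_1) cplx \<Rightarrow> ('y, 'a) cplx \<Rightarrow>
    (int \<Rightarrow> ('x \<Rightarrow>\<^sub>0 'a) \<Rightarrow> ('y \<Rightarrow>\<^sub>0 'a)) \<Rightarrow> bool"
  where "chain_map C D f \<longleftrightarrow> (\<forall>n. module_hom smul smul (f n) \<and> f n ` md C n \<subseteq> md D n \<and>
    (\<forall>v\<in>md C n. bd D n (f n v) = f (n - 1) (bd C n v)))"

definition minimal_complex :: "'a::comm_ring_1 set \<Rightarrow> ('x, 'a) cplx \<Rightarrow> bool"
  where "minimal_complex m C \<longleftrightarrow> free_complex C \<and>
    (\<forall>n. bd C n ` md C n \<subseteq> ideal_times m (md C (n - 1)))"

text \<open>For a complex X with R in degree 0, \<open>one0 X\<close> is the element 1 of R, and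
  \<open>coord0 X\<close> is the identification of the module in degree 0 with R.\<close>

definition one0 :: "('x, 'a::comm_ring_1) cplx \<Rightarrow> ('x \<Rightarrow>\<^sub>0 'a)"
  where "one0 X = gen (the_elem (gens X 0))"

definition coord0 :: "('x, 'a::comm_ring_1) cplx \<Rightarrow> ('x \<Rightarrow>\<^sub>0 'a) \<Rightarrow> 'a"
  where "coord0 X v = Poly_Mapping.lookup v (the_elem (gens X 0))"

text \<open>Free resolutions of R/I with R in degree 0 and the natural surjection from R as augmentation.\<close>

definition free_resolution :: "('x, 'a::comm_ring_1) cplx \<Rightarrow> 'a set \<Rightarrow> bool"
  where "free_resolution X I \<longleftrightarrow> free_complex X \<and>
    (\<forall>n<0. gens X n = {}) \<and> (\<exists>u. gens X 0 = {u}) \<and>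
    (\<forall>n\<ge>1. {v \<in> md X n. bd X n v = 0} = bd X (n + 1) ` md X (n + 1)) \<and>
    coord0 X ` bd X 1 ` md X 1 = I"

text \<open>For a free module F, the tensor product of F with R/B is F/BF.  So in positive degrees i the
  module of i-cycles of the tensor product of F with R/B is the image of \<open>tor_cycles F B i\<close>, and the
  module of i-boundaries is the image of \<open>tor_boundaries F B i\<close>; both contain the kernel BF.
  A finitely generated module over a noetherian ring has a resolution by finite free modules, whence
  the natural numbers suffice to index the bases of a resolution F computing Tor.\<close>

definition tor_cycles :: "('x, 'a::comm_ring_1) cplx \<Rightarrow> 'a set \<Rightarrow> int \<Rightarrow> ('x \<Rightarrow>\<^sub>0 'a) set"
  where "tor_cycles F B i = {z \<in> md F i. bd F i z \<in> ideal_times B (md F (i - 1))}"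

definition tor_boundaries :: "('x, 'a::comm_ring_1) cplx \<Rightarrow> 'a set \<Rightarrow> int \<Rightarrow> ('x \<Rightarrow>\<^sub>0 'a) set"
  where "tor_boundaries F B i =
    {bd F (i + 1) w + u | w u. w \<in> md F (i + 1) \<and> u \<in> ideal_times B (md F i)}"

definition tor_independent :: "'a::comm_ring_1 set \<Rightarrow> 'a set \<Rightarrow> bool"
  where "tor_independent A B \<longleftrightarrow>
    (\<exists>F :: (nat, 'a) cplx. free_resolution F A \<and> (\<forall>i\<ge>1. tor_cycles F B i = tor_boundaries F B i))"

text \<open>A graded free module is a free module with an internal degree \<open>\<delta> x\<close> for each basis element x,
  and \<open>graded_part G \<delta> B e\<close> is its component of internal degree e.  Graded maps have degree 0.\<close>

definition graded_part :: "(int \<Rightarrow> 'a::comm_ring_1 set) \<Rightarrow> ('x \<Rightarrow> int) \<Rightarrow> 'x set \<Rightarrow> int \<Rightarrow> ('x \<Rightarrow>\<^sub>0 'a) set"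
  where "graded_part G \<delta> B e = {v \<in> free_mod B. \<forall>x\<in>B. Poly_Mapping.lookup v x \<in> G (e - \<delta> x)}"

definition graded_complex :: "(int \<Rightarrow> 'a::comm_ring_1 set) \<Rightarrow> (int \<Rightarrow> 'x \<Rightarrow> int) \<Rightarrow> ('x, 'a) cplx \<Rightarrow> bool"
  where "graded_complex G \<delta> C \<longleftrightarrow> (\<forall>n e. bd C n ` graded_part G (\<delta> n) (gens C n) e
    \<subseteq> graded_part G (\<delta> (n - 1)) (gens C (n - 1)) e)"

definition graded_resolution :: "(int \<Rightarrow> 'a::comm_ring_1 set) \<Rightarrow> (int \<Rightarrow> 'x \<Rightarrow> int) \<Rightarrow> ('x, 'a) cplx \<Rightarrow> 'a set \<Rightarrow> bool"
  where "graded_resolution G \<delta> X I \<longleftrightarrow> free_resolution X I \<and> graded_complex G \<delta> X \<and> (\<forall>u\<in>gens X 0. \<delta> 0 u = 0)"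

definition graded_chain_map :: "(int \<Rightarrow> 'a::comm_ring_1 set) \<Rightarrow> (int \<Rightarrow> 'x \<Rightarrow> int) \<Rightarrow> ('x, 'a) cplx \<Rightarrow>
    (int \<Rightarrow> 'y \<Rightarrow> int) \<Rightarrow> ('y, 'a) cplx \<Rightarrow> (int \<Rightarrow> ('x \<Rightarrow>\<^sub>0 'a) \<Rightarrow> ('y \<Rightarrow>\<^sub>0 'a)) \<Rightarrow> bool"
  where "graded_chain_map G \<delta> C \<epsilon> D f \<longleftrightarrow> chain_map C D f \<and>
    (\<forall>n e. f n ` graded_part G (\<delta> n) (gens C n) e \<subseteq> graded_part G (\<epsilon> n) (gens D n) e)"

definition truncate1 :: "('x, 'a::comm_ring_1) cplx \<Rightarrow> ('x, 'a) cplx"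
  where "truncate1 C = \<lparr>gens = (\<lambda>n. if n \<ge> 1 then gens C n else {}),
    bd = (\<lambda>n. if n > 1 then bd C n else (\<lambda>_. 0))\<rparr>"

definition shift :: "int \<Rightarrow> ('x, 'a::comm_ring_1) cplx \<Rightarrow> ('x, 'a) cplx"
  where "shift l C = \<lparr>gens = (\<lambda>n. gens C (n - l)), bd = (\<lambda>n v. smul (ksign l) (bd C (n - l) v))\<rparr>"

definition tensor :: "('x, 'a::comm_ring_1) cplx \<Rightarrow> ('y, 'a) cplx \<Rightarrow> ((int \<times> 'x) \<times> (int \<times> 'y), 'a) cplx"
  where "tensor C D = \<lparr>
    gens = (\<lambda>n. {((i, x), (j, y)) | i x j y. i + j = n \<and> x \<in> gens C i \<and> y \<in> gens D j}),
    bd = (\<lambda>n. lin_ext (\<lambda>((i, x), (j, y)).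
      tens (i - 1) (bd C i (gen x)) j (gen y) + smul (ksign i) (tens i (gen x) (j - 1) (bd D j (gen y)))))\<rparr>"

lemma tensor_bd:
  assumes "free_complex C" "free_complex D"
  shows "bd (tensor C D) (i + j) (tens i v j w) =
    tens (i - 1) (bd C i v) j w + smul (ksign i) (tens i v (j - 1) (bd D j w))" (is "_ = ?f v w")
proof -
  have C: "module_hom smul smul (bd C i)" and D: "module_hom smul smul (bd D j)"
    using assms by (auto simp: free_complex_def)
  have T: "module_hom smul smul (bd (tensor C D) (i + j))"
    by (simp add: tensor_def module_hom_lin_ext)
  have l: "module_hom smul smul (\<lambda>v. ?f v w)" for w
    by (intro module_hom_plus module_hom_cmult module_hom_comp[OF C] module_hom_tens_left)
  have r: "module_hom smul smul (?f v)" for v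
    by (intro module_hom_plus module_hom_cmult module_hom_comp[OF D] module_hom_tens_right)
  have *: "bd (tensor C D) (i + j) (tens i (gen x) j w) = ?f (gen x) w" for x w
    by (rule module_hom_eq_on_gens[OF module_hom_comp[OF module_hom_tens_right T] r, of _ UNIV])
      (simp_all add: tensor_def free_mod_def)
  show ?thesis
    by (rule module_hom_eq_on_gens[OF module_hom_comp[OF module_hom_tens_left T] l, of _ UNIV])
      (simp_all add: * free_mod_def)
qed

definition star :: "('x, 'a::comm_ring_1) cplx \<Rightarrow> ('y, 'a) cplx \<Rightarrow> ((int \<times> 'x) \<times> (int \<times> 'y), 'a) cplx"
  where "star X Y = \<lparr>
    gens = (\<lambda>n. if n \<ge> 1 then gens (tensor (truncate1 X) (truncate1 Y)) (n + 1)
      else if n = 0 then {((0, x), (0, y)) | x y. x \<in> gens X 0 \<and> y \<in> gens Y 0} else {}),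
    bd = (\<lambda>n. if n \<ge> 2 then bd (tensor (truncate1 X) (truncate1 Y)) (n + 1)
      else if n = 1 then lin_ext (\<lambda>((_, x), (_, y)). tens 0 (bd X 1 (gen x)) 0 (bd Y 1 (gen y)))
      else (\<lambda>_. 0))\<rparr>"

lemma star_bd_1:
  assumes "free_complex X" "free_complex Y"
  shows "bd (star X Y) 1 (tens 1 v 1 w) = tens 0 (bd X 1 v) 0 (bd Y 1 w)"
proof -
  have X: "module_hom smul smul (bd X 1)" and Y: "module_hom smul smul (bd Y 1)"
    using assms by (auto simp: free_complex_def)
  show ?thesis
    using tens_universal(2)[OF module_hom_comp[OF X module_hom_tens_left]
        module_hom_comp[OF Y module_hom_tens_right], of 0 0 1 v 1 w]
    by (simp add: star_def)
qed

definition inl :: "('x \<Rightarrow>\<^sub>0 'a::comm_ring_1) \<Rightarrow> ('x + 'y \<Rightarrow>\<^sub>0 'a)"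
  where "inl = lin_ext (\<lambda>x. gen (Inl x))"

definition inr :: "('y \<Rightarrow>\<^sub>0 'a::comm_ring_1) \<Rightarrow> ('x + 'y \<Rightarrow>\<^sub>0 'a)"
  where "inr = lin_ext (\<lambda>y. gen (Inr y))"

definition copair :: "(('x \<Rightarrow>\<^sub>0 'a) \<Rightarrow> ('z \<Rightarrow>\<^sub>0 'a)) \<Rightarrow> (('y \<Rightarrow>\<^sub>0 'a) \<Rightarrow> ('z \<Rightarrow>\<^sub>0 'a)) \<Rightarrow>
    ('x + 'y \<Rightarrow>\<^sub>0 'a::comm_ring_1) \<Rightarrow> ('z \<Rightarrow>\<^sub>0 'a)"
  where "copair f g = lin_ext (case_sum (\<lambda>x. f (gen x)) (\<lambda>y. g (gen y)))"

lemma copair_inl_inr: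
  assumes f: "module_hom smul smul f" and g: "module_hom smul smul g"
  shows "copair f g (inl v + inr w) = f v + g w"
proof -
  have c: "module_hom smul smul (copair f g)"
    unfolding copair_def by (rule module_hom_lin_ext)
  have "copair f g (inl v) = f v"
    by (rule module_hom_eq_on_gens[OF module_hom_comp[OF _ c] f, of _ _ UNIV])
      (auto simp: inl_def copair_def free_mod_def intro: module_hom_lin_ext)
  moreover have "copair f g (inr w) = g w"
    by (rule module_hom_eq_on_gens[OF module_hom_comp[OF _ c] g, of _ _ UNIV])
      (auto simp: inr_def copair_def free_mod_def intro: module_hom_lin_ext)
  ultimately show ?thesis
    by (simp add: module_hom.add[OF c])
qed

definition dsum :: "('x, 'a::comm_ring_1) cplx \<Rightarrow> ('y, 'a) cplx \<Rightarrow> ('x + 'y, 'a) cplx"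
  where "dsum C D = \<lparr>gens = (\<lambda>n. gens C n <+> gens D n),
    bd = (\<lambda>n. copair (\<lambda>v. inl (bd C n v)) (\<lambda>w. inr (bd D n w)))\<rparr>"

definition cone :: "('y, 'a::comm_ring_1) cplx \<Rightarrow> ('x, 'a) cplx \<Rightarrow> (int \<Rightarrow> ('y \<Rightarrow>\<^sub>0 'a) \<Rightarrow> ('x \<Rightarrow>\<^sub>0 'a)) \<Rightarrow> ('x + 'y, 'a) cplx"
  where "cone C D f = \<lparr>gens = (\<lambda>n. gens D n <+> gens C (n - 1)),
    bd = (\<lambda>n. copair (\<lambda>d. inl (bd D n d)) (\<lambda>c. inl (f (n - 1) c) - inr (bd C (n - 1) c)))\<rparr>"

lemma module_hom_inl: "module_hom smul smul inl" and module_hom_inr: "module_hom smul smul inr"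
  by (simp_all add: inl_def inr_def module_hom_lin_ext)

lemma cone_bd:
  assumes "free_complex C" "free_complex D" and f: "module_hom smul smul (f (n - 1))"
  shows "bd (cone C D f) n (inl d + inr c) = inl (bd D n d + f (n - 1) c) + inr (- bd C (n - 1) c)"
proof -
  have C: "module_hom smul smul (bd C (n - 1))" and D: "module_hom smul smul (bd D n)"
    using assms by (auto simp: free_complex_def)
  interpret l: module_hom smul smul inl by (rule module_hom_inl)
  interpret r: module_hom smul smul inr by (rule module_hom_inr)
  have "module_hom smul smul (\<lambda>c. inl (f (n - 1) c) + smul (- 1) (inr (bd C (n - 1) c)))"
    by (intro module_hom_plus module_hom_cmult module_hom_comp[OF f] module_hom_comp[OF C]
        module_hom_inl module_hom_inr)
  then have g: "module_hom smul smul (\<lambda>c. inl (f (n - 1) c) - inr (bd C (n - 1) c))"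
    by simp
  show ?thesis
    by (simp add: cone_def copair_inl_inr[OF module_hom_comp[OF D module_hom_inl] g] l.add r.neg)
qed

text \<open>In the cases where a factor of degree 0 is involved, the element of \<open>S\<close> (or \<open>T\<close>) of degree 0 is
  regarded as an element of R, and hence as an element of X (or Y) of degree 0.\<close>

definition Phi :: "('s, 'a::comm_ring_1) cplx \<Rightarrow> ('x, 'a) cplx \<Rightarrow> (int \<Rightarrow> ('s \<Rightarrow>\<^sub>0 'a) \<Rightarrow> ('x \<Rightarrow>\<^sub>0 'a)) \<Rightarrow> int \<Rightarrow>
    (((int \<times> 's) \<times> (int \<times> 'y)) \<Rightarrow>\<^sub>0 'a) \<Rightarrow> (((int \<times> 'x) \<times> (int \<times> 'y)) \<Rightarrow>\<^sub>0 'a)"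
  where "Phi S X \<phi> n = lin_ext (\<lambda>((i, s), (j, y)).
    if j > 0 then smul (ksign (i + j)) (tens i (\<phi> i (gen s)) j (gen y))
    else if i = 1 then tens 0 (smul (coord0 S (bd S 1 (gen s))) (one0 X)) 0 (gen y)
    else 0)"

definition Psi :: "('t, 'a::comm_ring_1) cplx \<Rightarrow> ('y, 'a) cplx \<Rightarrow> (int \<Rightarrow> ('t \<Rightarrow>\<^sub>0 'a) \<Rightarrow> ('y \<Rightarrow>\<^sub>0 'a)) \<Rightarrow> int \<Rightarrow>
    (((int \<times> 'x) \<times> (int \<times> 't)) \<Rightarrow>\<^sub>0 'a) \<Rightarrow> (((int \<times> 'x) \<times> (int \<times> 'y)) \<Rightarrow>\<^sub>0 'a)"
  where "Psi T Y \<psi> n = lin_ext (\<lambda>((i, x), (j, t)).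
    if i > 0 then smul (ksign (i + j - 1)) (tens i (gen x) j (\<psi> j (gen t)))
    else if j = 1 then tens 0 (gen x) 0 (smul (coord0 T (bd T 1 (gen t))) (one0 Y))
    else 0)"

lemma module_hom_coord0_smul: "module_hom smul smul f \<Longrightarrow>
    module_hom smul smul (\<lambda>v. smul (coord0 S (f v)) (u :: 'x \<Rightarrow>\<^sub>0 'a::comm_ring_1))"
proof -
  assume "module_hom smul smul f"
  then interpret module_hom smul smul f .
  show ?thesis
    by unfold_locales (simp_all add: coord0_def add scale lookup_add free.scale_left_distrib)
qed

lemma Phi_tens:
  assumes S: "free_complex S" and \<phi>: "chain_map S X \<phi>"
  shows "Phi S X \<phi> n (tens i \<alpha> j \<beta>) =
    (if j > 0 then smul (ksign (i + j)) (tens i (\<phi> i \<alpha>) j \<beta>)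
     else if i = 1 then tens 0 (smul (coord0 S (bd S 1 \<alpha>)) (one0 X)) 0 \<beta>
     else 0)" (is "_ = ?f \<alpha> \<beta>")
proof -
  have p: "module_hom smul smul (\<phi> i)" and b: "module_hom smul smul (bd S 1)"
    using S \<phi> by (auto simp: free_complex_def chain_map_def)
  note h = module_hom_tens_left module_hom_tens_right module_hom_cmult module_hom_zero
    module_hom_comp[OF p] module_hom_comp[OF module_hom_coord0_smul[OF b]]
  have Phi: "module_hom smul smul (Phi S X \<phi> n)"
    unfolding Phi_def by (rule module_hom_lin_ext)
  have l: "module_hom smul smul (\<lambda>v. ?f v w)" for w
    by (intro h module_hom_If)
  have r: "module_hom smul smul (?f v)" for v
    by (intro h module_hom_If)
  have *: "Phi S X \<phi> n (tens i (gen x) j w) = ?f (gen x) w" for x w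
    by (rule module_hom_eq_on_gens[OF module_hom_comp[OF module_hom_tens_right Phi] r, of _ UNIV])
      (simp_all add: Phi_def free_mod_def)
  show ?thesis
    by (rule module_hom_eq_on_gens[OF module_hom_comp[OF module_hom_tens_left Phi] l, of _ UNIV])
      (simp_all add: * free_mod_def)
qed

lemma Psi_tens:
  assumes T: "free_complex T" and \<psi>: "chain_map T Y \<psi>"
  shows "Psi T Y \<psi> n (tens i \<alpha> j \<beta>) =
    (if i > 0 then smul (ksign (i + j - 1)) (tens i \<alpha> j (\<psi> j \<beta>))
     else if j = 1 then tens 0 \<alpha> 0 (smul (coord0 T (bd T 1 \<beta>)) (one0 Y))
     else 0)" (is "_ = ?f \<alpha> \<beta>")
proof -
  have p: "module_hom smul smul (\<psi> j)" and b: "module_hom smul smul (bd T 1)"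
    using T \<psi> by (auto simp: free_complex_def chain_map_def)
  note h = module_hom_tens_left module_hom_tens_right module_hom_cmult module_hom_zero
    module_hom_comp[OF p] module_hom_comp[OF module_hom_coord0_smul[OF b]]
  have Psi: "module_hom smul smul (Psi T Y \<psi> n)"
    unfolding Psi_def by (rule module_hom_lin_ext)
  have l: "module_hom smul smul (\<lambda>v. ?f v w)" for w
    by (intro h module_hom_If)
  have r: "module_hom smul smul (?f v)" for v
    by (intro h module_hom_If)
  have *: "Psi T Y \<psi> n (tens i (gen x) j w) = ?f (gen x) w" for x w
    by (rule module_hom_eq_on_gens[OF module_hom_comp[OF module_hom_tens_right Psi] r, of _ UNIV])
      (simp_all add: Psi_def free_mod_def)
  show ?thesis
    by (rule module_hom_eq_on_gens[OF module_hom_comp[OF module_hom_tens_left Psi] l, of _ UNIV])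
      (simp_all add: * free_mod_def)
qed

definition Omega_source :: "('s, 'a::comm_ring_1) cplx \<Rightarrow> ('y, 'a) cplx \<Rightarrow> ('x, 'a) cplx \<Rightarrow> ('t, 'a) cplx \<Rightarrow>
    ((int \<times> 's) \<times> (int \<times> 'y) + (int \<times> 'x) \<times> (int \<times> 't), 'a) cplx"
  where "Omega_source S Y X T =
    dsum (shift (- 1) (tensor (truncate1 S) Y)) (shift (- 1) (tensor X (truncate1 T)))"

definition Omega where
  "Omega S X \<phi> T Y \<psi> n = copair (Phi S X \<phi> n) (Psi T Y \<psi> n)"

definition cone_Omega where
  "cone_Omega S X \<phi> T Y \<psi> = cone (Omega_source S Y X T) (star X Y) (Omega S X \<phi> T Y \<psi>)"

end

theory Submission
  imports Defs
begin

text \<open>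
  Minimality of a complex is a condition on the matrix entries of its differential, so it suffices to
  look at basis elements.  The differential of the cone of \<open>\<Omega>\<close> has three parts: the differential of
  the star product, the differential of the source of \<open>\<Omega>\<close>, and \<open>\<Omega>\<close> itself.

  The first two parts are assembled from the differentials of the four minimal resolutions by
  truncation, shift, tensor product and direct sum.  Each of these operations preserves minimality,
  because a tensor \<open>v \<otimes> w\<close> has coefficients in \<open>m\<close> as soon as one of its factors has
  (\<open>tens_closed_ideal_times\<close>).  For the same reason the component of the star differential in degree 1,
  which is the tensor product of two differentials, is harmless (\<open>minimal_complex_star\<close>).

  The entries of \<open>\<Omega>\<close> are of two kinds.  Where both factors have positive degree they are entries of
  \<open>\<phi>\<close> or \<open>\<psi>\<close> and hence lie in \<open>I\<close> or \<open>J\<close>; where one factor has degree 0 they are entries of the first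
  differential of \<open>S\<close> or \<open>T\<close> and hence lie in \<open>I'\<close> or \<open>J'\<close>
  (\<open>Phi_entries\<close>, \<open>Psi_entries\<close>).  All four ideals are contained in \<open>m\<close>: the ideal resolved by a
  minimal resolution is generated by the entries of its first differential
  (\<open>minimal_resolution_ideal_subset\<close>).

  That the cone is a complex at all amounts to the fact that \<open>\<Omega>\<close> is a chain map, which is a
  computation with signs on tensors of basis elements (\<open>chain_map_Phi\<close>, \<open>chain_map_Psi\<close>).
\<close>

section \<open>Submodules of free modules\<close>

lemma gen_in_free_mod [simp]: "gen x \<in> (free_mod B :: ('x \<Rightarrow>\<^sub>0 'a::comm_ring_1) set) \<longleftrightarrow> x \<in> B"
  by (simp add: free_mod_def)

lemma subspace_free_mod: "free.subspace (free_mod B :: ('x \<Rightarrow>\<^sub>0 'a::comm_ring_1) set)"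
  unfolding free.subspace_def free_mod_def
proof (intro conjI allI ballI CollectI; clarsimp?)
  fix v w :: "'x \<Rightarrow>\<^sub>0 'a" and x
  assume "Poly_Mapping.keys v \<subseteq> B" "Poly_Mapping.keys w \<subseteq> B" "x \<in> Poly_Mapping.keys (v + w)"
  then show "x \<in> B" using Poly_Mapping.keys_add[of v w] by blast
next
  fix c and v :: "'x \<Rightarrow>\<^sub>0 'a" and x
  assume "Poly_Mapping.keys v \<subseteq> B" "x \<in> Poly_Mapping.keys (smul c v)"
  then show "x \<in> B" by (force simp: in_keys_iff)
qed

lemma subspace_md: "free.subspace (md C n)"
  by (simp add: md_def subspace_free_mod)

lemma module_hom_image_subset:
  fixes f :: "('x \<Rightarrow>\<^sub>0 'a::comm_ring_1) \<Rightarrow> ('y \<Rightarrow>\<^sub>0 'a)"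
  assumes f: "module_hom smul smul f" and N: "free.subspace N" and gens: "\<And>x. x \<in> B \<Longrightarrow> f (gen x) \<in> N"
  shows "f ` free_mod B \<subseteq> N"
proof (rule image_subsetI)
  fix v :: "'x \<Rightarrow>\<^sub>0 'a"
  assume v: "v \<in> free_mod B"
  have "f v = (\<Sum>x\<in>Poly_Mapping.keys v. smul (Poly_Mapping.lookup v x) (f (gen x)))"
    by (subst expand_gen[of v]) (simp add: module_hom.sum[OF f] module_hom.scale[OF f])
  also have "\<dots> \<in> N"
    using v by (intro free.subspace_sum[OF N] free.subspace_scale[OF N] gens) (auto simp: free_mod_def)
  finally show "f v \<in> N" .
qed

lemma subspace_ideal_times: "free.subspace (ideal_times m M)"
  by (simp add: ideal_times_def free.subspace_span)

lemma smul_in_ideal_times: "r \<in> m \<Longrightarrow> v \<in> M \<Longrightarrow> smul r v \<in> ideal_times m M"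
  unfolding ideal_times_def by (rule free.span_base) blast

lemma ideal_times_minimal:
  assumes "free.subspace N" "\<And>r v. r \<in> m \<Longrightarrow> v \<in> M \<Longrightarrow> smul r v \<in> N"
  shows "ideal_times m M \<subseteq> N"
  unfolding ideal_times_def by (rule free.span_minimal[OF _ assms(1)]) (use assms(2) in blast)

lemma ideal_times_subset: "free.subspace M \<Longrightarrow> ideal_times m M \<subseteq> M"
  by (rule ideal_times_minimal) (auto intro: free.subspace_scale)

lemma ideal_times_mono: "m \<subseteq> m' \<Longrightarrow> ideal_times m M \<subseteq> ideal_times m' M"
  by (rule ideal_times_minimal[OF subspace_ideal_times]) (blast intro: smul_in_ideal_times)

text \<open>Linearity pulls scalars out.  Applied to inclusions of summands and to tensoring with a fixed
  element, this transports the property of having coefficients in \<open>m\<close> to the modules of the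
  complexes below.\<close>

lemma module_hom_ideal_times:
  assumes f: "module_hom smul smul f" and M: "f ` M \<subseteq> N"
  shows "f ` ideal_times m M \<subseteq> ideal_times m N"
proof -
  have "ideal_times m M \<subseteq> {v. f v \<in> ideal_times m N}"
  proof (rule ideal_times_minimal)
    show "free.subspace {v. f v \<in> ideal_times m N}"
      using subspace_ideal_times[of m N]
      by (auto simp: free.subspace_def module_hom.zero[OF f] module_hom.add[OF f] module_hom.scale[OF f])
    show "smul r v \<in> {v. f v \<in> ideal_times m N}" if "r \<in> m" "v \<in> M" for r v
      using that M by (auto simp: module_hom.scale[OF f] intro: smul_in_ideal_times)
  qed
  then show ?thesis by blast
qed

text \<open>The coordinates of an element of the span are linear combinations of elements of \<open>m\<close>, so they
  lie in \<open>m\<close> once \<open>m\<close> is an ideal.\<close>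

lemma lookup_ideal_times:
  assumes "is_ideal m" "v \<in> ideal_times m M"
  shows "Poly_Mapping.lookup v x \<in> m"
proof -
  note m = module.subspace_0[OF module_mult assms(1)] module.subspace_add[OF module_mult assms(1)]
    module.subspace_scale[OF module_mult assms(1)]
  have "ideal_times m M \<subseteq> {v. Poly_Mapping.lookup v x \<in> m}"
  proof (rule ideal_times_minimal)
    show "free.subspace {v :: 'b \<Rightarrow>\<^sub>0 'a. Poly_Mapping.lookup v x \<in> m}"
      by (auto simp: free.subspace_def lookup_add m)
    show "smul r v \<in> {v. Poly_Mapping.lookup v x \<in> m}" if "r \<in> m" for r and v :: "'b \<Rightarrow>\<^sub>0 'a"
      using m(3)[OF that, of "Poly_Mapping.lookup v x"] by (simp add: mult.commute)
  qed
  then show ?thesis using assms(2) by blast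
qed

lemma tens_closed:
  assumes N: "free.subspace N" and v: "v \<in> free_mod B" and w: "w \<in> free_mod C"
    and gens: "\<And>x y. x \<in> B \<Longrightarrow> y \<in> C \<Longrightarrow> gen ((i, x), (j, y)) \<in> N"
  shows "tens i v j w \<in> N"
proof -
  have "(\<lambda>w. tens i (gen x) j w) ` free_mod C \<subseteq> N" if "x \<in> B" for x
    by (rule module_hom_image_subset[OF module_hom_tens_right N]) (simp add: gens that)
  then have "(\<lambda>v. tens i v j w) ` free_mod B \<subseteq> N"
    using w by (intro module_hom_image_subset[OF module_hom_tens_left N]) blast
  then show ?thesis using v by blast
qed

text \<open>By bilinearity, one factor with coefficients in \<open>m\<close> suffices.\<close>

lemma tens_closed_ideal_times:
  assumes gens: "\<And>x y. x \<in> B \<Longrightarrow> y \<in> C \<Longrightarrow> ((i, x), (j, y)) \<in> D"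
    and "v \<in> ideal_times m (free_mod B) \<and> w \<in> free_mod C \<or> v \<in> free_mod B \<and> w \<in> ideal_times m (free_mod C)"
  shows "tens i v j w \<in> ideal_times m (free_mod D)"
proof -
  have *: "tens i v j w \<in> free_mod D" if "v \<in> free_mod B" "w \<in> free_mod C" for v w
    by (rule tens_closed[OF subspace_free_mod that]) (simp add: gens)
  show ?thesis
    using assms(2)
  proof (elim disjE conjE)
    assume v: "v \<in> ideal_times m (free_mod B)" and w: "w \<in> free_mod C"
    have "(\<lambda>v. tens i v j w) ` free_mod B \<subseteq> free_mod D" using * w by blast
    from module_hom_ideal_times[OF module_hom_tens_left this] v show ?thesis by blast
  next
    assume v: "v \<in> free_mod B" and w: "w \<in> ideal_times m (free_mod C)"
    have "(\<lambda>w. tens i v j w) ` free_mod C \<subseteq> free_mod D" using * v by blast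
    from module_hom_ideal_times[OF module_hom_tens_right this] w show ?thesis by blast
  qed
qed

lemma tens_zero [simp]: "tens i 0 j w = 0" "tens i v j 0 = 0"
  using module_hom.zero[OF module_hom_tens_left] module_hom.zero[OF module_hom_tens_right] by blast+

section \<open>Minimal complexes\<close>

lemma free_complexD:
  assumes "free_complex C"
  shows "module_hom smul smul (bd C n)" "v \<in> md C n \<Longrightarrow> bd C n v \<in> md C (n - 1)"
    "v \<in> md C n \<Longrightarrow> bd C (n - 1) (bd C n v) = 0"
  using assms by (auto simp: free_complex_def)

lemma chain_mapD:
  assumes "chain_map C D f"
  shows "module_hom smul smul (f n)" "v \<in> md C n \<Longrightarrow> f n v \<in> md D n"
    "v \<in> md C n \<Longrightarrow> bd D n (f n v) = f (n - 1) (bd C n v)"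
  using assms by (auto simp: chain_map_def)

lemma free_complexI:
  assumes "\<And>n. module_hom smul smul (bd C n)"
    and "\<And>n x. x \<in> gens C n \<Longrightarrow> bd C n (gen x) \<in> md C (n - 1)"
    and "\<And>n x. x \<in> gens C n \<Longrightarrow> bd C (n - 1) (bd C n (gen x)) = 0"
  shows "free_complex C"
  unfolding free_complex_def
proof (intro allI conjI ballI)
  fix n
  show "bd C n ` md C n \<subseteq> md C (n - 1)"
    unfolding md_def[of C n] by (rule module_hom_image_subset[OF assms(1) subspace_md assms(2)])
  show "bd C (n - 1) (bd C n v) = 0" if "v \<in> md C n" for v
    using module_hom_eq_on_gens[OF module_hom_comp[OF assms(1) assms(1)] module_hom_zero
        that[unfolded md_def] assms(3)] .
qed (rule assms(1))

lemma chain_mapI: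
  assumes "free_complex C" "free_complex D" "\<And>n. module_hom smul smul (f n)"
    and "\<And>n x. x \<in> gens C n \<Longrightarrow> f n (gen x) \<in> md D n"
    and "\<And>n x. x \<in> gens C n \<Longrightarrow> bd D n (f n (gen x)) = f (n - 1) (bd C n (gen x))"
  shows "chain_map C D f"
  unfolding chain_map_def
proof (intro allI conjI ballI)
  fix n
  show "f n ` md C n \<subseteq> md D n"
    unfolding md_def[of C n] by (rule module_hom_image_subset[OF assms(3) subspace_md assms(4)])
  show "bd D n (f n v) = f (n - 1) (bd C n v)" if "v \<in> md C n" for v
    using module_hom_eq_on_gens[OF module_hom_comp[OF assms(3) free_complexD(1)[OF assms(2)]]
        module_hom_comp[OF free_complexD(1)[OF assms(1)] assms(3)] that[unfolded md_def] assms(5)] .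
qed (rule assms(3))

lemma gen_in_md [simp]: "gen x \<in> (md C n :: ('x \<Rightarrow>\<^sub>0 'a::comm_ring_1) set) \<longleftrightarrow> x \<in> gens C n"
  by (simp add: md_def)

lemma ideal_times_UNIV: "free.subspace M \<Longrightarrow> ideal_times UNIV M = M"
  using ideal_times_subset[of M UNIV] smul_in_ideal_times[of 1 UNIV _ M] by fastforce

lemma zero_in_ideal_times [simp]: "0 \<in> ideal_times m M"
  by (rule free.subspace_0[OF subspace_ideal_times])

text \<open>The entries of the differential in \<open>m\<close> already force it to map into the next module, so that
  being a complex is left only with the vanishing of the composites.\<close>

lemma minimal_complexI:
  assumes hom: "\<And>n. module_hom smul smul (bd C n)"
    and entries: "\<And>n x. x \<in> gens C n \<Longrightarrow> bd C n (gen x) \<in> ideal_times m (md C (n - 1))"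
    and "\<And>n x. x \<in> gens C n \<Longrightarrow> bd C (n - 1) (bd C n (gen x)) = 0"
  shows "minimal_complex m C"
  unfolding minimal_complex_def
proof (intro conjI allI)
  show "free_complex C"
    using assms ideal_times_subset[OF subspace_md] by (intro free_complexI) blast+
  show "bd C n ` md C n \<subseteq> ideal_times m (md C (n - 1))" for n
    unfolding md_def[of C n] by (rule module_hom_image_subset[OF hom subspace_ideal_times entries])
qed

lemma minimal_complexD:
  assumes "minimal_complex m C"
  shows "free_complex C" "v \<in> md C n \<Longrightarrow> bd C n v \<in> ideal_times m (md C (n - 1))"
  using assms by (auto simp: minimal_complex_def)

text \<open>Since \<open>m\<close> is an arbitrary set in the lemmas on constructions of minimal complexes, taking the whole
  ring for it turns each of them into the corresponding statement on complexes of free modules.\<close>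

lemma minimal_complex_UNIV: "minimal_complex UNIV C \<longleftrightarrow> free_complex C"
  by (auto simp: minimal_complex_def ideal_times_UNIV[OF subspace_md] dest: free_complexD(2))

section \<open>Truncation, shift, tensor product and star product\<close>

lemma truncate1_simps:
  "gens (truncate1 C) n = (if n \<ge> 1 then gens C n else {})"
  "bd (truncate1 C) n = (if n > 1 then bd C n else (\<lambda>_. 0))"
  by (simp_all add: truncate1_def)

lemma minimal_complex_truncate1:
  assumes "minimal_complex m C"
  shows "minimal_complex m (truncate1 C)"
proof -
  note C = minimal_complexD[OF assms] free_complexD[OF minimal_complexD(1)[OF assms]]
  show ?thesis
  proof (rule minimal_complexI)
    show "module_hom smul smul (bd (truncate1 C) n)" for n
      by (simp add: truncate1_simps C module_hom_zero)
    show "bd (truncate1 C) n (gen x) \<in> ideal_times m (md (truncate1 C) (n - 1))"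
      if "x \<in> gens (truncate1 C) n" for n x
      using C(2)[of "gen x" n] that by (auto simp: truncate1_simps md_def split: if_splits)
    show "bd (truncate1 C) (n - 1) (bd (truncate1 C) n (gen x)) = 0"
      if "x \<in> gens (truncate1 C) n" for n x
      using C(5)[of "gen x" n] C(3)[THEN module_hom.zero] that
      by (auto simp: truncate1_simps split: if_splits)
  qed
qed

text \<open>The exponents occur in the shapes produced by lowering the degree of one factor of a tensor.\<close>

lemma ksign_simps:
  "ksign (i - 1) = - ksign i" "ksign (i + 1) = - ksign i" "ksign (i - 1 + j) = - ksign (i + j)" "ksign (i + (j - 1)) = - ksign (i + j)"
  "ksign (i + j - 1) = - ksign (i + j)" "ksign (i - 1 + j - 1) = ksign (i + j)"
  "ksign (i + (j - 1) - 1) = ksign (i + j)" "ksign i * ksign i = 1" "ksign (- 1) = - 1" "ksign 1 = - 1"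
  by (auto simp: ksign_def)

lemma minimal_complex_shift:
  assumes "minimal_complex m C"
  shows "minimal_complex m (shift l C)"
proof -
  note C = minimal_complexD[OF assms] free_complexD[OF minimal_complexD(1)[OF assms]]
  have ix: "n - 1 - l = n - l - 1" for n by simp
  show ?thesis
  proof (rule minimal_complexI)
    show "module_hom smul smul (bd (shift l C) n)" for n
      by (simp add: shift_def C module_hom_cmult)
    show "bd (shift l C) n (gen x) \<in> ideal_times m (md (shift l C) (n - 1))"
      if "x \<in> gens (shift l C) n" for n x
      using C(2)[of "gen x" "n - l"] that
      by (simp add: shift_def md_def ix free.subspace_scale[OF subspace_ideal_times])
    show "bd (shift l C) (n - 1) (bd (shift l C) n (gen x)) = 0"
      if "x \<in> gens (shift l C) n" for n x
      using C(5)[of "gen x" "n - l"] that by (simp add: shift_def ix module_hom.scale[OF C(3)])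
  qed
qed

lemma gens_tensor_iff [simp]:
  "((i, x), (j, y)) \<in> gens (tensor C D) n \<longleftrightarrow> i + j = n \<and> x \<in> gens C i \<and> y \<in> gens D j"
  by (auto simp: tensor_def)

lemma gens_tensorE:
  assumes "p \<in> gens (tensor C D) n"
  obtains i x j y where "p = ((i, x), (j, y))" "i + j = n" "x \<in> gens C i" "y \<in> gens D j"
  using assms by (auto simp: tensor_def)

text \<open>The differential of a tensor product reads the degrees off the basis elements, so its degree
  index \<open>n\<close> is arbitrary.  Two applications in a row then need no
  comparison of the degrees \<open>(i - 1) + j\<close>, \<open>i + (j - 1)\<close> and \<open>n - 1\<close>.\<close>

lemma bd_tensor_tens:
  assumes "free_complex C" "free_complex D"
  shows "bd (tensor C D) n (tens i v j w) =
    tens (i - 1) (bd C i v) j w + smul (ksign i) (tens i v (j - 1) (bd D j w))"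
  using tensor_bd[OF assms, of i j v w] by (simp add: tensor_def)

lemma bd_tensor_gen:
  "bd (tensor C D) n (gen ((i, x), (j, y))) =
    tens (i - 1) (bd C i (gen x)) j (gen y) + smul (ksign i) (tens i (gen x) (j - 1) (bd D j (gen y)))"
  by (simp add: tensor_def)

lemma minimal_complex_tensor:
  assumes "minimal_complex m C" "minimal_complex m D"
  shows "minimal_complex m (tensor C D)"
proof -
  note C = minimal_complexD[OF assms(1)] and D = minimal_complexD[OF assms(2)]
  have hom: "module_hom smul smul (bd (tensor C D) n)" for n
    by (simp add: tensor_def module_hom_lin_ext)
  show ?thesis
  proof (rule minimal_complexI[OF hom])
    fix n p
    assume "p \<in> gens (tensor C D) n"
    then obtain i x j y where p: "p = ((i, x), (j, y))" "i + j = n" and xy: "x \<in> gens C i" "y \<in> gens D j"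
      by (rule gens_tensorE)
    have dx: "bd C i (gen x) \<in> ideal_times m (free_mod (gens C (i - 1)))"
      and dy: "bd D j (gen y) \<in> ideal_times m (free_mod (gens D (j - 1)))"
      using C(2)[of "gen x" i] D(2)[of "gen y" j] xy by (simp_all add: md_def)
    have "tens (i - 1) (bd C i (gen x)) j (gen y) \<in> ideal_times m (md (tensor C D) (n - 1))"
      unfolding md_def
      by (rule tens_closed_ideal_times[where B = "gens C (i - 1)" and C = "gens D j"]) (use p xy dx in auto)
    moreover have "tens i (gen x) (j - 1) (bd D j (gen y)) \<in> ideal_times m (md (tensor C D) (n - 1))"
      unfolding md_def
      by (rule tens_closed_ideal_times[where B = "gens C i" and C = "gens D (j - 1)"]) (use p xy dy in auto)
    ultimately show "bd (tensor C D) n (gen p) \<in> ideal_times m (md (tensor C D) (n - 1))"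
      unfolding p bd_tensor_gen
      by (intro free.subspace_add free.subspace_scale subspace_ideal_times)
    show "bd (tensor C D) (n - 1) (bd (tensor C D) n (gen p)) = 0"
      using free_complexD(3)[OF C(1), of "gen x" i] free_complexD(3)[OF D(1), of "gen y" j] xy
      by (simp add: p bd_tensor_gen module_hom.add[OF hom] module_hom.scale[OF hom]
          bd_tensor_tens[OF C(1) D(1)] ksign_simps free.scale_right_distrib)
  qed
qed

lemma free_complex_tensor: "free_complex C \<Longrightarrow> free_complex D \<Longrightarrow> free_complex (tensor C D)"
  using minimal_complex_tensor[of UNIV C D] by (simp add: minimal_complex_UNIV)

lemma free_complex_truncate1: "free_complex C \<Longrightarrow> free_complex (truncate1 C)"
  using minimal_complex_truncate1[of UNIV C] by (simp add: minimal_complex_UNIV)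

lemma free_complex_shift: "free_complex C \<Longrightarrow> free_complex (shift l C)"
  using minimal_complex_shift[of UNIV C] by (simp add: minimal_complex_UNIV)

lemma gens_star:
  "n \<ge> 1 \<Longrightarrow> gens (star X Y) n = gens (tensor (truncate1 X) (truncate1 Y)) (n + 1)"
  "gens (star X Y) 0 = {((0, x), (0, y)) | x y. x \<in> gens X 0 \<and> y \<in> gens Y 0}"
  "n < 0 \<Longrightarrow> gens (star X Y) n = {}"
  by (simp_all add: star_def)

lemma bd_star:
  "n \<ge> 2 \<Longrightarrow> bd (star X Y) n = bd (tensor (truncate1 X) (truncate1 Y)) (n + 1)"
  "n \<le> 0 \<Longrightarrow> bd (star X Y) n = (\<lambda>_. 0)"
  by (simp_all add: star_def)

text \<open>In degrees at least 2 the star product is a shifted tensor product of truncations.  In degree 1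
  the entries of the differential are products of entries of \<open>\<partial>\<^sub>1\<close> of \<open>X\<close> and of \<open>Y\<close>, and its composite with the differential of
  degree 2 vanishes because every basis element of degree 2 comes from degrees \<open>(1, 2)\<close> or \<open>(2, 1)\<close>,
  where two successive differentials meet in one factor.\<close>

lemma minimal_complex_star:
  assumes "minimal_complex m X" "minimal_complex m Y"
  shows "minimal_complex m (star X Y)"
proof -
  note X = minimal_complexD[OF assms(1)] and Y = minimal_complexD[OF assms(2)]
  let ?T = "tensor (truncate1 X) (truncate1 Y)"
  have T: "minimal_complex m ?T"
    by (intro minimal_complex_tensor minimal_complex_truncate1 assms)
  have hom: "module_hom smul smul (bd (star X Y) n)" for n
    by (simp add: star_def tensor_def module_hom_lin_ext module_hom_zero)
  show ?thesis
  proof (rule minimal_complexI[OF hom])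
    fix n p
    assume p: "p \<in> gens (star X Y) n"
    consider "n \<le> 0" | "n = 1" | "n = 2" | "n \<ge> 3" by linarith
    then have "bd (star X Y) n (gen p) \<in> ideal_times m (md (star X Y) (n - 1)) \<and>
      bd (star X Y) (n - 1) (bd (star X Y) n (gen p)) = 0"
    proof cases
      case 1
      then show ?thesis by (simp add: bd_star)
    next
      case 2
      then obtain i x j y where "p = ((i, x), (j, y))" "x \<in> gens X i" "y \<in> gens Y j"
        and "1 \<le> i" "1 \<le> j" "i + j = 2"
        using p by (auto simp: gens_star truncate1_simps elim!: gens_tensorE split: if_splits)
      moreover from this have "i = 1" "j = 1" by linarith+
      ultimately have xy: "p = ((1, x), (1, y))" "x \<in> gens X 1" "y \<in> gens Y 1" by auto
      have "tens 0 (bd X 1 (gen x)) 0 (bd Y 1 (gen y)) \<in> ideal_times m (free_mod (gens (star X Y) 0))"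
        by (rule tens_closed_ideal_times[where B = "gens X 0" and C = "gens Y 0"])
          (use xy X(2)[of "gen x" 1] free_complexD(2)[OF Y(1), of "gen y" 1] in \<open>auto simp: md_def gens_star\<close>)
      then show ?thesis
        using star_bd_1[OF X(1) Y(1), of "gen x" "gen y"] 2 by (simp add: bd_star md_def xy)
    next
      case 3
      then obtain i x j y where xy: "p = ((i, x), (j, y))" "x \<in> gens X i" "y \<in> gens Y j"
        and "1 \<le> i" "1 \<le> j" "i + j = 3"
        using p by (auto simp: gens_star truncate1_simps elim!: gens_tensorE split: if_splits)
      then have ij: "i = 1 \<and> j = 2 \<or> i = 2 \<and> j = 1" by linarith
      have "bd (star X Y) 2 (gen p) \<in> ideal_times m (md (star X Y) 1)"
        using minimal_complexD(2)[OF T, of "gen p" 3] p 3 by (simp add: bd_star gens_star md_def)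
      moreover have "bd (star X Y) 1 (bd (star X Y) 2 (gen p)) = 0"
        using ij free_complexD(3)[OF X(1), of "gen x" 2] free_complexD(3)[OF Y(1), of "gen y" 2] xy
        by (auto simp: bd_star bd_tensor_gen truncate1_simps star_bd_1[OF X(1) Y(1)] module_hom.scale[OF hom])
      ultimately show ?thesis using 3 by simp
    next
      case 4
      then show ?thesis
        using minimal_complexD(2)[OF T, of "gen p" "n + 1"]
          free_complexD(3)[OF minimal_complexD(1)[OF T], of "gen p" "n + 1"] p
        by (simp add: bd_star gens_star md_def)
    qed
    then show "bd (star X Y) n (gen p) \<in> ideal_times m (md (star X Y) (n - 1))"
      "bd (star X Y) (n - 1) (bd (star X Y) n (gen p)) = 0" by auto
  qed
qed

lemma free_complex_star: "free_complex X \<Longrightarrow> free_complex Y \<Longrightarrow> free_complex (star X Y)"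
  using minimal_complex_star[of UNIV X Y] by (simp add: minimal_complex_UNIV)

section \<open>Direct sums and cones\<close>

lemma inl_gen [simp]: "inl (gen x) = gen (Inl x)" and inr_gen [simp]: "inr (gen y) = gen (Inr y)"
  by (simp_all add: inl_def inr_def)

lemma inl_image: "inl ` free_mod B \<subseteq> free_mod (B <+> C)"
  and inr_image: "inr ` free_mod C \<subseteq> free_mod (B <+> C)"
  by (rule module_hom_image_subset; simp add: module_hom_inl module_hom_inr subspace_free_mod InlI InrI)+

lemma inl_ideal_times: "v \<in> ideal_times m (free_mod B) \<Longrightarrow> inl v \<in> ideal_times m (free_mod (B <+> C))"
  and inr_ideal_times: "w \<in> ideal_times m (free_mod C) \<Longrightarrow> inr w \<in> ideal_times m (free_mod (B <+> C))"
  using module_hom_ideal_times[OF module_hom_inl inl_image] module_hom_ideal_times[OF module_hom_inr inr_image]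
  by blast+

lemma copair_gen [simp]: "copair f g (gen (Inl x)) = f (gen x)" "copair f g (gen (Inr y)) = g (gen y)"
  by (simp_all add: copair_def)

lemma copair_inl:
  assumes "module_hom smul smul f" "module_hom smul smul g"
  shows "copair f g (inl v) = f v" "copair f g (inr w) = g w"
  using copair_inl_inr[OF assms, of v 0] copair_inl_inr[OF assms, of 0 w]
  by (simp_all add: module_hom.zero[OF module_hom_inl] module_hom.zero[OF module_hom_inr]
      module_hom.zero[OF assms(1)] module_hom.zero[OF assms(2)])

lemma module_hom_copair: "module_hom smul smul (copair f g)"
  by (simp add: copair_def module_hom_lin_ext)

lemma minimal_complex_dsum:
  assumes "minimal_complex m C" "minimal_complex m D"
  shows "minimal_complex m (dsum C D)"
proof -
  note C = minimal_complexD[OF assms(1)] and D = minimal_complexD[OF assms(2)]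
  have hom: "module_hom smul smul (bd (dsum C D) n)" for n
    by (simp add: dsum_def module_hom_copair)
  note homs = module_hom_comp[OF free_complexD(1)[OF C(1)] module_hom_inl]
    module_hom_comp[OF free_complexD(1)[OF D(1)] module_hom_inr]
  show ?thesis
  proof (rule minimal_complexI[OF hom])
    fix n p
    assume "p \<in> gens (dsum C D) n"
    then consider x where "p = Inl x" "x \<in> gens C n" | y where "p = Inr y" "y \<in> gens D n"
      by (auto simp: dsum_def)
    then have "bd (dsum C D) n (gen p) \<in> ideal_times m (md (dsum C D) (n - 1)) \<and>
      bd (dsum C D) (n - 1) (bd (dsum C D) n (gen p)) = 0"
      using C(2)[of _ n] D(2)[of _ n] free_complexD(3)[OF C(1), of _ n] free_complexD(3)[OF D(1), of _ n]
      by cases (auto simp: dsum_def md_def copair_inl[OF homs] module_hom.zero[OF module_hom_inl]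
          module_hom.zero[OF module_hom_inr] intro: inl_ideal_times inr_ideal_times)
    then show "bd (dsum C D) n (gen p) \<in> ideal_times m (md (dsum C D) (n - 1))"
      "bd (dsum C D) (n - 1) (bd (dsum C D) n (gen p)) = 0" by auto
  qed
qed

lemma chain_map_copair:
  assumes C: "free_complex C" and D: "free_complex D" and E: "free_complex E"
    and f: "chain_map C E f" and g: "chain_map D E g"
  shows "chain_map (dsum C D) E (\<lambda>n. copair (f n) (g n))"
proof (rule chain_mapI)
  show "free_complex (dsum C D)"
    using minimal_complex_dsum[of UNIV C D] C D by (simp add: minimal_complex_UNIV)
next
  fix n p
  assume "p \<in> gens (dsum C D) n"
  then consider x where "p = Inl x" "x \<in> gens C n" | y where "p = Inr y" "y \<in> gens D n"
    by (auto simp: dsum_def)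
  then have "copair (f n) (g n) (gen p) \<in> md E n \<and>
    bd E n (copair (f n) (g n) (gen p)) = copair (f (n - 1)) (g (n - 1)) (bd (dsum C D) n (gen p))"
    by cases (auto simp: dsum_def copair_inl[OF chain_mapD(1)[OF f] chain_mapD(1)[OF g]]
      chain_mapD[OF f] chain_mapD[OF g])
  then show "copair (f n) (g n) (gen p) \<in> md E n"
    "bd E n (copair (f n) (g n) (gen p)) = copair (f (n - 1)) (g (n - 1)) (bd (dsum C D) n (gen p))" by auto
qed (simp_all add: E module_hom_copair)

text \<open>The differential of the cone is a triangular matrix with the two given differentials on the
  diagonal and the chain map off it, so minimality needs the entries of the chain map in \<open>m\<close> as well.\<close>

lemma minimal_complex_cone:
  assumes "minimal_complex m C" "minimal_complex m D" and f: "chain_map C D f"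
    and entries: "\<And>n x. x \<in> gens C n \<Longrightarrow> f n (gen x) \<in> ideal_times m (md D n)"
  shows "minimal_complex m (cone C D f)"
proof -
  note C = minimal_complexD[OF assms(1)] and D = minimal_complexD[OF assms(2)]
  note c = free_complexD[OF C(1)] and d = free_complexD[OF D(1)]
  have hom: "module_hom smul smul (bd (cone C D f) n)" for n
    by (simp add: cone_def module_hom_copair)
  interpret l: module_hom smul smul inl by (rule module_hom_inl)
  interpret r: module_hom smul smul inr by (rule module_hom_inr)
  have bd2: "bd (cone C D f) n (inl v - inr w) = inl (bd D n v - f (n - 1) w) + inr (bd C (n - 1) w)" for n v w
    using cone_bd[OF C(1) D(1), of f n v "- w"]
    by (simp add: chain_mapD(1)[OF f] module_hom.neg[OF chain_mapD(1)[OF f]] module_hom.neg[OF c(1)] r.neg)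
  show ?thesis
  proof (rule minimal_complexI[OF hom])
    fix n p
    assume "p \<in> gens (cone C D f) n"
    then consider y where "p = Inl y" "y \<in> gens D n" | x where "p = Inr x" "x \<in> gens C (n - 1)"
      by (auto simp: cone_def)
    then have "bd (cone C D f) n (gen p) \<in> ideal_times m (md (cone C D f) (n - 1)) \<and>
      bd (cone C D f) (n - 1) (bd (cone C D f) n (gen p)) = 0"
    proof cases
      case 1
      have *: "bd (cone C D f) n (gen p) = inl (bd D n (gen y))"
        using 1 by (simp add: cone_def)
      show ?thesis
        using 1 D(2)[of "gen y" n] bd2[of "n - 1" "bd D n (gen y)" 0] d(3)[of "gen y" n]
        unfolding *
        by (simp add: cone_def md_def inl_ideal_times module_hom.zero[OF chain_mapD(1)[OF f]] module_hom.zero[OF c(1)])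
    next
      case 2
      have *: "bd (cone C D f) n (gen p) = inl (f (n - 1) (gen x)) - inr (bd C (n - 1) (gen x))"
        using 2 by (simp add: cone_def)
      have "inl (f (n - 1) (gen x)) - inr (bd C (n - 1) (gen x)) \<in> ideal_times m (md (cone C D f) (n - 1))"
        using entries[of x "n - 1"] C(2)[of "gen x" "n - 1"] 2
        by (intro free.subspace_diff[OF subspace_ideal_times])
          (simp_all add: cone_def md_def inl_ideal_times inr_ideal_times)
      moreover have "bd (cone C D f) (n - 1) (inl (f (n - 1) (gen x)) - inr (bd C (n - 1) (gen x))) = 0"
        using chain_mapD(3)[OF f, of "gen x" "n - 1"] c(3)[of "gen x" "n - 1"] 2 by (simp add: bd2)
      ultimately show ?thesis unfolding * by blast
    qed
    then show "bd (cone C D f) n (gen p) \<in> ideal_times m (md (cone C D f) (n - 1))"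
      "bd (cone C D f) (n - 1) (bd (cone C D f) n (gen p)) = 0" by auto
  qed
qed

section \<open>The chain maps into the star product\<close>

lemma free_resolutionD:
  assumes "free_resolution X I"
  shows "free_complex X" "n < 0 \<Longrightarrow> gens X n = {}" "n < 0 \<Longrightarrow> md X n = {0}"
    "\<exists>u. gens X 0 = {u}" "coord0 X ` bd X 1 ` md X 1 = I"
  using assms by (auto simp: free_resolution_def md_def free_mod_def)

text \<open>The module in degree 0 is free on the single element 1, so its elements are scalars; this makes
  sense of elements of \<open>S\<close> in degree 0 as elements of \<open>X\<close> in degree 0.\<close>

lemma coord0_one0:
  assumes "free_resolution X I" "v \<in> md X 0"
  shows "smul (coord0 X v) (one0 X) = v"
proof -
  obtain u where u: "gens X 0 = {u}" using free_resolutionD(4)[OF assms(1)] by blast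
  have "Poly_Mapping.lookup v y = 0" if "y \<noteq> u" for y
    using assms(2) that by (auto simp: md_def free_mod_def u in_keys_iff)
  then show ?thesis
    by (intro poly_mapping_eqI) (auto simp: coord0_def one0_def u lookup_single when_def)
qed

lemma one0_in_md:
  assumes "free_resolution X I"
  shows "one0 X \<in> md X 0"
proof -
  obtain u where "gens X 0 = {u}" using free_resolutionD(4)[OF assms] by blast
  then show ?thesis by (simp add: one0_def)
qed

lemma chain_map_degree0:
  assumes S: "free_resolution S I'" and \<phi>: "chain_map S X \<phi>" "\<phi> 0 (one0 S) = one0 X" and v: "v \<in> md S 0"
  shows "\<phi> 0 v = smul (coord0 S v) (one0 X)"
  using module_hom.scale[OF chain_mapD(1)[OF \<phi>(1)], of 0 "coord0 S v" "one0 S"]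
  by (simp add: coord0_one0[OF S v] \<phi>(2))

text \<open>A chain map also commutes with the truncated differentials: in degree 1 both of them vanish.\<close>

lemma truncate1_chain_map:
  assumes "chain_map S X \<phi>" "v \<in> md S i"
  shows "\<phi> (i - 1) (bd (truncate1 S) i v) = bd (truncate1 X) i (\<phi> i v)"
  using chain_mapD(3)[OF assms] module_hom.zero[OF chain_mapD(1)[OF assms(1)]] by (simp add: truncate1_simps)

text \<open>The set \<open>m\<close> is arbitrary.  With an ideal this gives the entries needed for minimality; with the
  whole ring it says that \<open>\<Phi>\<close> maps into the star product, which is needed for the chain map property.\<close>

lemma Phi_entries:
  fixes S :: "('s, 'a::comm_ring_1) cplx" and X :: "('x, 'a) cplx" and Y :: "('y, 'a) cplx"
  assumes X: "free_resolution X I" and Y: "free_resolution Y J"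
    and entries: "\<And>i s. i \<ge> 1 \<Longrightarrow> s \<in> gens S i \<Longrightarrow> \<phi> i (gen s) \<in> ideal_times m (md X i)"
    and coords: "\<And>s. s \<in> gens S 1 \<Longrightarrow> coord0 S (bd S 1 (gen s)) \<in> m"
    and p: "p \<in> gens (shift (- 1) (tensor (truncate1 S) Y)) n"
  shows "Phi S X \<phi> n (gen p) \<in> ideal_times m (md (star X Y) n)"
proof -
  obtain i s j y where p: "p = ((i, s), (j, y))" "i + j = n + 1" and s: "i \<ge> 1" "s \<in> gens S i" and y: "y \<in> gens Y j"
    using p by (auto simp: shift_def truncate1_simps elim!: gens_tensorE split: if_splits)
  have "j \<ge> 0" using free_resolutionD(2)[OF Y, of j] y by force
  then consider "j > 0" | "j = 0" "i = 1" | "j = 0" "i > 1" using s by linarith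
  then show ?thesis
  proof cases
    case 1
    have "tens i (\<phi> i (gen s)) j (gen y) \<in> ideal_times m (md (star X Y) n)"
      unfolding md_def
      by (rule tens_closed_ideal_times[where B = "gens X i" and C = "gens Y j"])
        (use 1 p s y entries[of i s] in \<open>auto simp: gens_star truncate1_simps md_def\<close>)
    then show ?thesis
      using 1 by (simp add: Phi_def p free.subspace_scale[OF subspace_ideal_times])
  next
    case 2
    have "tens 0 (smul (coord0 S (bd S 1 (gen s))) (one0 X)) 0 (gen y :: 'y \<Rightarrow>\<^sub>0 'a) \<in> ideal_times m (md (star X Y) n)"
      unfolding md_def
      by (rule tens_closed_ideal_times[where B = "gens X 0" and C = "gens Y 0"])
        (use 2 p s y coords[of s] one0_in_md[OF X] in
          \<open>auto simp: gens_star md_def intro: smul_in_ideal_times\<close>)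
    then show ?thesis
      using 2 by (simp add: Phi_def p)
  next
    case 3
    then show ?thesis by (simp add: Phi_def p)
  qed
qed

text \<open>On a tensor of basis elements of degrees \<open>i\<close> and \<open>j\<close>, three cases have to be distinguished.  For
  \<open>j = 0\<close> both sides vanish.  For \<open>i = j = 1\<close> the degree 1 differential of the star product appears, and
  the identity reduces to \<open>\<partial>\<phi> = \<phi>\<partial>\<close> into degree 0, where \<open>\<phi>\<close> is the identity of the ring.  In
  the remaining cases all differentials are those of tensor products of truncations, and the sign in
  \<open>\<Phi>\<close> absorbs the sign of the shift.\<close>

lemma chain_map_Phi:
  assumes X: "free_resolution X I" and Y: "free_resolution Y J" and S: "free_resolution S I'"
    and \<phi>: "chain_map S X \<phi>" "\<phi> 0 (one0 S) = one0 X"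
  shows "chain_map (shift (- 1) (tensor (truncate1 S) Y)) (star X Y) (Phi S X \<phi>)"
proof -
  note fX = free_resolutionD(1)[OF X] and fY = free_resolutionD(1)[OF Y] and fS = free_resolutionD(1)[OF S]
  let ?C = "tensor (truncate1 S) Y"
  have hom: "module_hom smul smul (Phi S X \<phi> n)" for n
    by (simp add: Phi_def module_hom_lin_ext)
  show ?thesis
  proof (rule chain_mapI)
    show "free_complex (shift (- 1) ?C)"
      by (intro free_complex_shift free_complex_tensor free_complex_truncate1 fS fY)
    show "free_complex (star X Y)"
      by (intro free_complex_star fX fY)
    fix n p
    assume p: "p \<in> gens (shift (- 1) ?C) n"
    show "Phi S X \<phi> n (gen p) \<in> md (star X Y) n"
      using Phi_entries[where m = UNIV, OF X Y _ _ p] chain_mapD(2)[OF \<phi>(1)]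
      by (simp add: ideal_times_UNIV[OF subspace_md])
    obtain i s j y where pe: "p = ((i, s), (j, y))" "i + j = n + 1" and s: "i \<ge> 1" "s \<in> gens S i" and y: "y \<in> gens Y j"
      using p by (auto simp: shift_def truncate1_simps elim!: gens_tensorE split: if_splits)
    have "j \<ge> 0" using free_resolutionD(2)[OF Y, of j] y by force
    have bd: "bd (shift (- 1) ?C) n (gen p) =
        - (tens (i - 1) (bd (truncate1 S) i (gen s)) j (gen y) + smul (ksign i) (tens i (gen s) (j - 1) (bd Y j (gen y))))"
      by (simp add: shift_def pe bd_tensor_gen ksign_simps)
    note simps = module_hom.add[OF hom] module_hom.scale[OF hom] module_hom.neg[OF hom] module_hom.diff[OF hom]
      Phi_tens[OF fS \<phi>(1)] ksign_simps
    have Phi_p: "Phi S X \<phi> n (gen p) = 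
      (if j > 0 then smul (ksign (i + j)) (tens i (\<phi> i (gen s)) j (gen y))
       else if i = 1 then tens 0 (smul (coord0 S (bd S 1 (gen s))) (one0 X)) 0 (gen y)
       else 0)"
      by (simp add: Phi_def pe)
    consider "j = 0" | "j = 1" "i = 1" | "j > 0" "n \<ge> 2" using \<open>j \<ge> 0\<close> s pe by linarith
    then show "bd (star X Y) n (Phi S X \<phi> n (gen p)) = Phi S X \<phi> (n - 1) (bd (shift (- 1) ?C) n (gen p))"
    proof cases
      case 1
      \<comment> \<open>For \<open>i = 2\<close> the value of \<open>\<Phi>\<close> on the boundary involves two successive differentials of \<open>S\<close>.\<close>
      have "bd Y 0 (gen y) = 0"
        using free_complexD(2)[OF fY, of "gen y" 0] y 1 free_resolutionD(3)[OF Y, of "-1"] by simp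
      moreover have "coord0 S (bd S 1 (bd S 2 (gen s))) = 0" if "i = 2"
        using free_complexD(3)[OF fS, of "gen s" 2] s that by (simp add: coord0_def)
      moreover have "bd (star X Y) n 0 = 0"
        using free_complexD(1)[OF free_complex_star[OF fX fY]] by (rule module_hom.zero)
      ultimately show ?thesis
        using 1 s pe unfolding Phi_p bd
        by (auto simp: simps bd_star truncate1_simps)
    next
      case 2
      have "bd X 1 (\<phi> 1 (gen s)) = smul (coord0 S (bd S 1 (gen s))) (one0 X)"
        using chain_mapD(3)[OF \<phi>(1), of "gen s" 1] free_complexD(2)[OF fS, of "gen s" 1] s 2
        by (simp add: chain_map_degree0[OF S \<phi>])
      then show ?thesis
        using 2 pe unfolding Phi_p bd
        by (simp add: simps truncate1_simps star_bd_1[OF fX fY] ksign_def)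
    next
      case 3
      have "bd (star X Y) n (Phi S X \<phi> n (gen p)) = smul (ksign (i + j))
          (tens (i - 1) (\<phi> (i - 1) (bd (truncate1 S) i (gen s))) j (gen y) +
           smul (ksign i) (tens i (\<phi> i (gen s)) (j - 1) (bd (truncate1 Y) j (gen y))))"
        using 3 s truncate1_chain_map[OF \<phi>(1), of "gen s" i] free_complexD(1)[OF free_complex_star[OF fX fY]]
        by (simp add: Phi_p module_hom.scale bd_star module_hom.scale[OF free_complexD(1)[OF free_complex_tensor]]
            free_complex_truncate1 fX fY bd_tensor_tens)
      \<comment> \<open>For \<open>j = 1\<close> the second summand vanishes on the left by truncation of \<open>Y\<close>, and on the right
        because \<open>\<Phi>\<close> is 0 on tensors of degrees \<open>(i, 0)\<close> with \<open>i > 1\<close>.\<close>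
      also have "\<dots> = Phi S X \<phi> (n - 1) (bd (shift (- 1) ?C) n (gen p))"
        using 3 pe s unfolding bd by (cases "j = 1") (simp_all add: simps truncate1_simps free.scale_right_distrib mult.commute)
      finally show ?thesis .
    qed
  qed (rule hom)
qed

lemma Psi_entries:
  fixes T :: "('t, 'a::comm_ring_1) cplx" and X :: "('x, 'a) cplx" and Y :: "('y, 'a) cplx"
  assumes X: "free_resolution X I" and Y: "free_resolution Y J"
    and entries: "\<And>j t. j \<ge> 1 \<Longrightarrow> t \<in> gens T j \<Longrightarrow> \<psi> j (gen t) \<in> ideal_times m (md Y j)"
    and coords: "\<And>t. t \<in> gens T 1 \<Longrightarrow> coord0 T (bd T 1 (gen t)) \<in> m"
    and p: "p \<in> gens (shift (- 1) (tensor X (truncate1 T))) n"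
  shows "Psi T Y \<psi> n (gen p) \<in> ideal_times m (md (star X Y) n)"
proof -
  obtain i x j t where p: "p = ((i, x), (j, t))" "i + j = n + 1" and t: "j \<ge> 1" "t \<in> gens T j" and x: "x \<in> gens X i"
    using p by (auto simp: shift_def truncate1_simps elim!: gens_tensorE split: if_splits)
  have "i \<ge> 0" using free_resolutionD(2)[OF X, of i] x by force
  then consider "i > 0" | "i = 0" "j = 1" | "i = 0" "j > 1" using t by linarith
  then show ?thesis
  proof cases
    case 1
    have "tens i (gen x) j (\<psi> j (gen t)) \<in> ideal_times m (md (star X Y) n)"
      unfolding md_def
      by (rule tens_closed_ideal_times[where B = "gens X i" and C = "gens Y j"])
        (use 1 p t x entries[of j t] in \<open>auto simp: gens_star truncate1_simps md_def\<close>)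
    then show ?thesis
      using 1 by (simp add: Psi_def p free.subspace_scale[OF subspace_ideal_times])
  next
    case 2
    have "tens 0 (gen x :: 'x \<Rightarrow>\<^sub>0 'a) 0 (smul (coord0 T (bd T 1 (gen t))) (one0 Y)) \<in> ideal_times m (md (star X Y) n)"
      unfolding md_def
      by (rule tens_closed_ideal_times[where B = "gens X 0" and C = "gens Y 0"])
        (use 2 p t x coords[of t] one0_in_md[OF Y] in
          \<open>auto simp: gens_star md_def intro: smul_in_ideal_times\<close>)
    then show ?thesis
      using 2 by (simp add: Psi_def p)
  next
    case 3
    then show ?thesis by (simp add: Psi_def p)
  qed
qed

text \<open>The argument for \<open>\<Phi>\<close> with the roles of the factors exchanged.  The differential of the second
  factor carries the Koszul sign of the first; this is why the exponent in \<open>\<Psi>\<close> is one less than the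
  exponent in \<open>\<Phi>\<close>, as the case \<open>i = j = 1\<close> shows.\<close>

lemma chain_map_Psi:
  assumes X: "free_resolution X I" and Y: "free_resolution Y J" and T: "free_resolution T J'"
    and \<psi>: "chain_map T Y \<psi>" "\<psi> 0 (one0 T) = one0 Y"
  shows "chain_map (shift (- 1) (tensor X (truncate1 T))) (star X Y) (Psi T Y \<psi>)"
proof -
  note fX = free_resolutionD(1)[OF X] and fY = free_resolutionD(1)[OF Y] and fT = free_resolutionD(1)[OF T]
  let ?C = "tensor X (truncate1 T)"
  have hom: "module_hom smul smul (Psi T Y \<psi> n)" for n
    by (simp add: Psi_def module_hom_lin_ext)
  show ?thesis
  proof (rule chain_mapI)
    show "free_complex (shift (- 1) ?C)"
      by (intro free_complex_shift free_complex_tensor free_complex_truncate1 fX fT)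
    show "free_complex (star X Y)"
      by (intro free_complex_star fX fY)
    fix n p
    assume p: "p \<in> gens (shift (- 1) ?C) n"
    show "Psi T Y \<psi> n (gen p) \<in> md (star X Y) n"
      using Psi_entries[where m = UNIV, OF X Y _ _ p] chain_mapD(2)[OF \<psi>(1)]
      by (simp add: ideal_times_UNIV[OF subspace_md])
    obtain i x j t where pe: "p = ((i, x), (j, t))" "i + j = n + 1" and t: "j \<ge> 1" "t \<in> gens T j" and x: "x \<in> gens X i"
      using p by (auto simp: shift_def truncate1_simps elim!: gens_tensorE split: if_splits)
    have "i \<ge> 0" using free_resolutionD(2)[OF X, of i] x by force
    have bd: "bd (shift (- 1) ?C) n (gen p) =
        - (tens (i - 1) (bd X i (gen x)) j (gen t) + smul (ksign i) (tens i (gen x) (j - 1) (bd (truncate1 T) j (gen t))))"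
      by (simp add: shift_def pe bd_tensor_gen ksign_simps)
    note simps = module_hom.add[OF hom] module_hom.scale[OF hom] module_hom.neg[OF hom] module_hom.diff[OF hom]
      Psi_tens[OF fT \<psi>(1)] ksign_simps
    have Psi_p: "Psi T Y \<psi> n (gen p) = 
      (if i > 0 then smul (ksign (i + j - 1)) (tens i (gen x) j (\<psi> j (gen t)))
       else if j = 1 then tens 0 (gen x) 0 (smul (coord0 T (bd T 1 (gen t))) (one0 Y))
       else 0)"
      by (simp add: Psi_def pe)
    consider "i = 0" | "i = 1" "j = 1" | "i > 0" "n \<ge> 2" using \<open>i \<ge> 0\<close> t pe by linarith
    then show "bd (star X Y) n (Psi T Y \<psi> n (gen p)) = Psi T Y \<psi> (n - 1) (bd (shift (- 1) ?C) n (gen p))"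
    proof cases
      case 1
      have "bd X 0 (gen x) = 0"
        using free_complexD(2)[OF fX, of "gen x" 0] x 1 free_resolutionD(3)[OF X, of "-1"] by simp
      moreover have "coord0 T (bd T 1 (bd T 2 (gen t))) = 0" if "j = 2"
        using free_complexD(3)[OF fT, of "gen t" 2] t that by (simp add: coord0_def)
      moreover have "bd (star X Y) n 0 = 0"
        using free_complexD(1)[OF free_complex_star[OF fX fY]] by (rule module_hom.zero)
      ultimately show ?thesis
        using 1 t pe unfolding Psi_p bd
        by (auto simp: simps bd_star truncate1_simps)
    next
      case 2
      have "bd Y 1 (\<psi> 1 (gen t)) = smul (coord0 T (bd T 1 (gen t))) (one0 Y)"
        using chain_mapD(3)[OF \<psi>(1), of "gen t" 1] free_complexD(2)[OF fT, of "gen t" 1] t 2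
        by (simp add: chain_map_degree0[OF T \<psi>])
      then show ?thesis
        using 2 pe unfolding Psi_p bd
        by (simp add: simps truncate1_simps star_bd_1[OF fX fY]
            module_hom.neg[OF free_complexD(1)[OF free_complex_star[OF fX fY]]])
    next
      case 3
      have "bd (star X Y) n (Psi T Y \<psi> n (gen p)) = smul (ksign (i + j - 1))
          (tens (i - 1) (bd (truncate1 X) i (gen x)) j (\<psi> j (gen t)) +
           smul (ksign i) (tens i (gen x) (j - 1) (\<psi> (j - 1) (bd (truncate1 T) j (gen t)))))"
        using 3 t truncate1_chain_map[OF \<psi>(1), of "gen t" j] free_complexD(1)[OF free_complex_star[OF fX fY]]
        by (simp add: Psi_p module_hom.scale bd_star module_hom.scale[OF free_complexD(1)[OF free_complex_tensor]]
            free_complex_truncate1 fX fY bd_tensor_tens)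
      also have "\<dots> = Psi T Y \<psi> (n - 1) (bd (shift (- 1) ?C) n (gen p))"
        using 3 pe t unfolding bd by (cases "i = 1") (simp_all add: simps truncate1_simps free.scale_right_distrib mult.commute)
      finally show ?thesis .
    qed
  qed (rule hom)
qed

section \<open>Minimality of the cone\<close>

text \<open>The image of the first differential is the resolved ideal.\<close>

lemma minimal_resolution_ideal_subset:
  assumes "is_ideal m" "minimal_complex m X" "free_resolution X I"
  shows "I \<subseteq> m"
proof -
  have "coord0 X (bd X 1 v) \<in> m" if "v \<in> md X 1" for v
    unfolding coord0_def by (rule lookup_ideal_times[OF assms(1) minimal_complexD(2)[OF assms(2) that]])
  then show ?thesis using free_resolutionD(5)[OF assms(3)] by blast
qed

lemma minimal_complex_cone_Omega:
  assumes m: "is_ideal m"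
    and X: "free_resolution X I" "minimal_complex m X" and Y: "free_resolution Y J" "minimal_complex m Y"
    and S: "free_resolution S I'" "minimal_complex m S" and T: "free_resolution T J'" "minimal_complex m T"
    and \<phi>: "chain_map S X \<phi>" "\<phi> 0 (one0 S) = one0 X" "\<forall>i\<ge>1. \<phi> i ` md S i \<subseteq> ideal_times m (md X i)"
    and \<psi>: "chain_map T Y \<psi>" "\<psi> 0 (one0 T) = one0 Y" "\<forall>i\<ge>1. \<psi> i ` md T i \<subseteq> ideal_times m (md Y i)"
  shows "minimal_complex m (cone_Omega S X \<phi> T Y \<psi>)"
proof -
  let ?C = "shift (- 1) (tensor (truncate1 S) Y)" and ?D = "shift (- 1) (tensor X (truncate1 T))"
  have C: "minimal_complex m ?C" and D: "minimal_complex m ?D"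
    by (intro minimal_complex_shift minimal_complex_tensor minimal_complex_truncate1 X Y S T)+
  have E: "minimal_complex m (star X Y)"
    by (intro minimal_complex_star X Y)
  have phi: "\<phi> i (gen s) \<in> ideal_times m (md X i)" if "i \<ge> 1" "s \<in> gens S i" for i s
    using \<phi>(3) that gen_in_md[of s S i] by blast
  have psi: "\<psi> i (gen t) \<in> ideal_times m (md Y i)" if "i \<ge> 1" "t \<in> gens T i" for i t
    using \<psi>(3) that gen_in_md[of t T i] by blast
  have coordS: "coord0 S (bd S 1 (gen s)) \<in> m" if "s \<in> gens S 1" for s
    using minimal_resolution_ideal_subset[OF m S(2,1)] free_resolutionD(5)[OF S(1)] gen_in_md[of s S 1] that by blast
  have coordT: "coord0 T (bd T 1 (gen t)) \<in> m" if "t \<in> gens T 1" for t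
    using minimal_resolution_ideal_subset[OF m T(2,1)] free_resolutionD(5)[OF T(1)] gen_in_md[of t T 1] that by blast
  have "minimal_complex m (cone (dsum ?C ?D) (star X Y) (\<lambda>n. copair (Phi S X \<phi> n) (Psi T Y \<psi> n)))"
  proof (rule minimal_complex_cone[OF minimal_complex_dsum[OF C D] E])
    show "chain_map (dsum ?C ?D) (star X Y) (\<lambda>n. copair (Phi S X \<phi> n) (Psi T Y \<psi> n))"
      by (rule chain_map_copair[OF minimal_complexD(1)[OF C] minimal_complexD(1)[OF D] minimal_complexD(1)[OF E]
            chain_map_Phi[OF X(1) Y(1) S(1) \<phi>(1,2)] chain_map_Psi[OF X(1) Y(1) T(1) \<psi>(1,2)]])
    fix n p
    assume "p \<in> gens (dsum ?C ?D) n"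
    then consider c where "p = Inl c" "c \<in> gens ?C n" | d where "p = Inr d" "d \<in> gens ?D n"
      by (auto simp: dsum_def)
    then show "copair (Phi S X \<phi> n) (Psi T Y \<psi> n) (gen p) \<in> ideal_times m (md (star X Y) n)"
      using Phi_entries[where S = S and \<phi> = \<phi> and m = m, OF X(1) Y(1) phi coordS]
        Psi_entries[where T = T and \<psi> = \<psi> and m = m, OF X(1) Y(1) psi coordT]
      by cases simp_all
  qed
  moreover have "Omega S X \<phi> T Y \<psi> = (\<lambda>n. copair (Phi S X \<phi> n) (Psi T Y \<psi> n))"
    by (rule ext) (simp add: Omega_def)
  ultimately show ?thesis
    by (simp add: cone_Omega_def Omega_source_def)
qed

theorem theorem5p3:
  fixes m I J I' J' :: "'a::comm_ring_1 set"
    and X :: "('x, 'a) cplx" and Y :: "('y, 'a) cplx" and S :: "('s, 'a) cplx" and T :: "('t, 'a) cplx"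
    and \<phi> :: "int \<Rightarrow> ('s \<Rightarrow>\<^sub>0 'a) \<Rightarrow> ('x \<Rightarrow>\<^sub>0 'a)" and \<psi> :: "int \<Rightarrow> ('t \<Rightarrow>\<^sub>0 'a) \<Rightarrow> ('y \<Rightarrow>\<^sub>0 'a)"
  assumes "noetherian TYPE('a)"
    and "is_ideal I" "is_ideal J" "is_ideal I'" "is_ideal J'"
    and "I' \<subseteq> I" "J' \<subseteq> J"
    and "tor_independent I J" "tor_independent I' J" "tor_independent I J'"
    and "free_resolution X I" "free_resolution Y J" "free_resolution S I'" "free_resolution T J'"
    and "I' \<subseteq> ideal_prod I I" "J' \<subseteq> ideal_prod J J"
    and "\<exists>as. regular_sequence as \<and> I = ideal_gen (set as)"
    and "\<exists>bs. regular_sequence bs \<and> J = ideal_gen (set bs)"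
    and "minimal_complex m X" "minimal_complex m Y" "minimal_complex m S" "minimal_complex m T"
    and "chain_map S X \<phi>" "chain_map T Y \<psi>"
    and "\<phi> 0 (one0 S) = one0 X" "\<psi> 0 (one0 T) = one0 Y"
    and "\<forall>i\<ge>1. \<phi> i ` md S i \<subseteq> ideal_times I (md X i)"
    and "\<forall>i\<ge>1. \<psi> i ` md T i \<subseteq> ideal_times J (md Y i)"
    and "local_ring m \<or>
      (\<exists>G. standard_graded_ring G m \<and>
        homogeneous_ideal G I \<and> homogeneous_ideal G J \<and>
        homogeneous_ideal G I' \<and> homogeneous_ideal G J' \<and>
        (\<exists>as. regular_sequence as \<and> set as \<subseteq> homogeneous_elements G \<and> I = ideal_gen (set as)) \<and>
        (\<exists>bs. regular_sequence bs \<and> set bs \<subseteq> homogeneous_elements G \<and> J = ideal_gen (set bs)) \<and>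
        (\<exists>dX dY dS dT.
          graded_resolution G dX X I \<and> graded_resolution G dY Y J \<and>
          graded_resolution G dS S I' \<and> graded_resolution G dT T J' \<and>
          graded_chain_map G dS S dX X \<phi> \<and> graded_chain_map G dT T dY Y \<psi>))"
  shows "minimal_complex m (cone_Omega S X \<phi> T Y \<psi>)"
proof -
  have m: "is_ideal m"
    using assms(29) by (auto simp: local_ring_def standard_graded_ring_def maximal_ideal_def)
  have "\<forall>i\<ge>1. \<phi> i ` md S i \<subseteq> ideal_times m (md X i)"
    using assms(27) ideal_times_mono[OF minimal_resolution_ideal_subset[OF m assms(19,11)]] by blast
  moreover have "\<forall>i\<ge>1. \<psi> i ` md T i \<subseteq> ideal_times m (md Y i)"
    using assms(28) ideal_times_mono[OF minimal_resolution_ideal_subset[OF m assms(20,12)]] by blast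
  ultimately show ?thesis
    using minimal_complex_cone_Omega[OF m assms(11,19,12,20,13,21,14,22,23,25) _ assms(24,26)] by blast
qed

end
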